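(* Let $G=(V,E)$ be a finite compact metric graph with the standard Kirchhoff condition at every vertex (including vertices of degree one), and let the metric $\ell\in(0,\infty)^E$ belong to the generic class $\mathcal G_G$. Then $$I(\ell)=\overline{\widehat\Gamma_\ell(Z_G^{\mathrm{reg}})}.$$ Consequently, for every measurable $\omega\subset G$, with $\alpha_e=|\omega\cap e|$, $$C_\infty(\omega;\ell)=\min_{q\in\overline{\widehat\Gamma_\ell(Z_G^{\mathrm{reg}})}}\alpha\cdot q.$$
   Context: The standard Kirchhoff condition means continuity and vanishing sum of outward derivatives (so Neumann at degree-one vertices). $-\Delta_{G,\ell}$ is the corresponding Laplacian, acting as $-d^2/dx^2$ on each edge $e\cong[0,\ell_e]$. **Localization constant.** $C_\infty(\omega;\ell):=\lim_{\Lambda\to\infty}\inf\{\int_\omega|u|^2:\ -\Delta_{G,\ell}u=\lambda u,\ \lambda\ge\Lambda,\ \|u\|_{L^2(G)}=1\}$. **Attainable set.** For $-\Delta_{G,\ell}u=k^2u$, $k>0$, with $u_e(x)=A_e\cos(kx)+B_e\sin(kx)$, put $q_e(u)=(|A_e|^2+|B_e|^2)/2$. $I(\ell)$ is the set of all limits $\lim_n q(u_n)$ with $\|u_n\|_{L^2}=1$, $-\Delta_{G,\ell}u_n=k_n^2u_n$, $k_n\to\infty$. $P_\ell=\{q\in[0,\infty)^E:\ell\cdot q=1\}$. **Determinant manifold and Gauss map (Colin de Verdière).** Orient the edges. For $\theta\in\mathbb T^E=(\mathbb R/2\pi\mathbb Z)^E$ let $N(\theta)$ be the space of coefficient families $(A_e,B_e)_{e\in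 E}$ such that the edge functions $A_e\cos t+B_e\sin t$, having value $A_e$ and outward derivative $B_e$ at the initial endpoint, and value $A_e\cos\theta_e+B_e\sin\theta_e$ and outward derivative $A_e\sin\theta_e-B_e\cos\theta_e$ at the final endpoint, satisfy the Kirchhoff condition at every vertex. The determinant manifold is $Z_G=\{\theta:N(\theta)\ne0\}$; its regular part $Z_G^{\mathrm{reg}}$ is the set of $\theta$ with $\dim N(\theta)=1$, the complement of $Z_G^{\mathrm{reg}}$ in $Z_G$ being the singular part. The Gauss map sends $z\in Z_G^{\mathrm{reg}}$ to the positive ray $\Gamma(z)$ in $[0,\infty)^E\setminus\{0\}$ normal to $Z_G$ at $z$, i.e. the ray through $g(z)=(|A_e|^2+|B_e|^2)_{e}$ for any nonzero $(A,B)\in N(z)$. The normalized Gauss map is $\widehat\Gamma_\ell(z)=g(z)/(\ell\cdot g(z))\in P_\ell$. **Generic class.** $\mathcal G_G$ is the set of metrics $\ell$ whose components are rationally independent and whose phase line $\{k\ell \bmod 2\pi:k>0\}$ does not meet the singular part of $Z_G$; equivalently (in that setting) the positive Laplace spectrum is simple. *)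

theory Defs
  imports "HOL-Analysis.Analysis"
begin

text \<open>
  A finite oriented multigraph: loops and multiple edges are allowed, and the orientation of an
  edge only fixes which of its ends is the parameter value 0. Finiteness is carried by the sort of
  the two type variables, so the edge set is all of \<open>'e\<close>, and vectors indexed by \<open>E\<close> live in
  \<open>real ^ 'e\<close>. A function on the metric graph with edge lengths \<open>L\<close> is a family \<open>u\<close>, where \<open>u e\<close> is
  only meaningful on the interval from \<open>0\<close> to \<open>L $ e\<close>.
\<close>

record ('e, 'v) graph =
  src :: "'e \<Rightarrow> 'v"
  tgt :: "'e \<Rightarrow> 'v"

text \<open>
  The standard vertex condition, on boundary data: \<open>a e\<close>, \<open>b e\<close> are the values at the initial and the
  final endpoint of \<open>e\<close>, and \<open>a' e\<close>, \<open>b' e\<close> the derivatives at these endpoints in the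
  direction pointing from the vertex into the edge. A loop contributes both of its ends.
\<close>

definition kirchhoff ::
  "('e::finite, 'v::finite) graph \<Rightarrow> ('e \<Rightarrow> complex) \<Rightarrow> ('e \<Rightarrow> complex) \<Rightarrow>
     ('e \<Rightarrow> complex) \<Rightarrow> ('e \<Rightarrow> complex) \<Rightarrow> bool" where
  "kirchhoff G a b a' b' \<longleftrightarrow>
     (\<exists>\<phi> :: 'v \<Rightarrow> complex. \<forall>e. a e = \<phi> (src G e) \<and> b e = \<phi> (tgt G e)) \<and>
     (\<forall>v. (\<Sum>e | src G e = v. a' e) + (\<Sum>e | tgt G e = v. b' e) = 0)"

text \<open>The graph of the operator: \<open>u\<close> lies in the domain of the Laplacian and \<open>- \<Delta> u = f\<close>.\<close>

definition neg_laplacian ::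
  "('e::finite, 'v::finite) graph \<Rightarrow> real ^ 'e \<Rightarrow> ('e \<Rightarrow> real \<Rightarrow> complex) \<Rightarrow>
     ('e \<Rightarrow> real \<Rightarrow> complex) \<Rightarrow> bool" where
  "neg_laplacian G L u f \<longleftrightarrow>
     (\<exists>u'. (\<forall>e. \<forall>x\<in>{0..L $ e}.
              (u e has_vector_derivative u' e x) (at x within {0..L $ e}) \<and>
              (u' e has_vector_derivative - f e x) (at x within {0..L $ e})) \<and>
           kirchhoff G (\<lambda>e. u e 0) (\<lambda>e. u e (L $ e)) (\<lambda>e. u' e 0) (\<lambda>e. - u' e (L $ e)))"

definition eigen_eq ::
  "('e::finite, 'v::finite) graph \<Rightarrow> real ^ 'e \<Rightarrow> real \<Rightarrow> ('e \<Rightarrow> real \<Rightarrow> complex) \<Rightarrow> bool" where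
  "eigen_eq G L \<mu> u \<longleftrightarrow> neg_laplacian G L u (\<lambda>e x. complex_of_real \<mu> * u e x)"

text \<open>
  A subset of the metric graph is given by its traces on the edges. The two ends of edges meeting
  at a vertex are not required to agree about membership; this affects null sets only.
\<close>

definition measurable_part :: "real ^ 'e::finite \<Rightarrow> ('e \<Rightarrow> real set) \<Rightarrow> bool" where
  "measurable_part L \<omega> \<longleftrightarrow> (\<forall>e. \<omega> e \<in> sets lebesgue \<and> \<omega> e \<subseteq> {0..L $ e})"

definition edge_measures :: "('e::finite \<Rightarrow> real set) \<Rightarrow> real ^ 'e" where
  "edge_measures \<omega> = (\<chi> e. measure lebesgue (\<omega> e))"

definition mass :: "('e::finite \<Rightarrow> real set) \<Rightarrow> ('e \<Rightarrow> real \<Rightarrow> complex) \<Rightarrow> real" where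
  "mass \<omega> u = (\<Sum>e\<in>UNIV. LINT x : \<omega> e | lebesgue. (cmod (u e x))\<^sup>2)"

definition l2_norm :: "real ^ 'e::finite \<Rightarrow> ('e \<Rightarrow> real \<Rightarrow> complex) \<Rightarrow> real" where
  "l2_norm L u = sqrt (mass (\<lambda>e. {0..L $ e}) u)"

definition min_mass_above ::
  "('e::finite, 'v::finite) graph \<Rightarrow> real ^ 'e \<Rightarrow> ('e \<Rightarrow> real set) \<Rightarrow> real \<Rightarrow> real" where
  "min_mass_above G L \<omega> \<Lambda> =
     Inf {mass \<omega> u | u \<mu>. eigen_eq G L \<mu> u \<and> \<mu> \<ge> \<Lambda> \<and> l2_norm L u = 1}"

definition localization_constant ::
  "('e::finite, 'v::finite) graph \<Rightarrow> real ^ 'e \<Rightarrow> ('e \<Rightarrow> real set) \<Rightarrow> real" where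
  "localization_constant G L \<omega> = Lim at_top (min_mass_above G L \<omega>)"

text \<open>
  A coefficient family \<open>(A, B)\<close> is a single vector \<open>X\<close> with \<open>A\<^sub>e = X $ Inl e\<close> and
  \<open>B\<^sub>e = X $ Inr e\<close>, so that \<open>vec.dim\<close> is the complex dimension of spaces of such families.
\<close>

type_synonym 'e coeffs = "complex ^ ('e + 'e)"

definition coeff_energy :: "('e::finite) coeffs \<Rightarrow> real ^ 'e" where
  "coeff_energy X = (\<chi> e. (cmod (X $ Inl e))\<^sup>2 + (cmod (X $ Inr e))\<^sup>2)"

definition has_coeffs ::
  "real ^ 'e::finite \<Rightarrow> real \<Rightarrow> ('e \<Rightarrow> real \<Rightarrow> complex) \<Rightarrow> 'e coeffs \<Rightarrow> bool" where
  "has_coeffs L k u X \<longleftrightarrow>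
     (\<forall>e. \<forall>x\<in>{0..L $ e}.
        u e x = X $ Inl e * complex_of_real (cos (k * x)) + X $ Inr e * complex_of_real (sin (k * x)))"

definition attainable_set ::
  "('e::finite, 'v::finite) graph \<Rightarrow> real ^ 'e \<Rightarrow> (real ^ 'e) set" where
  "attainable_set G L =
     {q. \<exists>u k X.
           (\<forall>n::nat. k n > 0 \<and> eigen_eq G L ((k n)\<^sup>2) (u n) \<and> l2_norm L (u n) = 1 \<and>
                     has_coeffs L (k n) (u n) (X n)) \<and>
           filterlim k at_top sequentially \<and>
           (\<lambda>n. (1 / 2) *\<^sub>R coeff_energy (X n)) \<longlonglongrightarrow> q}"

text \<open>
  Points of the torus \<open>(\<real> / 2\<pi>\<int>)\<^sup>E\<close> are represented by arbitrary lifts \<open>\<theta>\<close>: everything below depends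
  on \<open>\<theta>\<close> only modulo \<open>2\<pi>\<close> (lemma \<open>nullspace_periodic\<close>), and the determinant manifold appears as its
  full periodic preimage.
\<close>

definition nullspace ::
  "('e::finite, 'v::finite) graph \<Rightarrow> real ^ 'e \<Rightarrow> 'e coeffs set" where
  "nullspace G \<theta> =
     {X. let A = (\<lambda>e. X $ Inl e); B = (\<lambda>e. X $ Inr e);
             c = (\<lambda>e. complex_of_real (cos (\<theta> $ e))); s = (\<lambda>e. complex_of_real (sin (\<theta> $ e)))
         in kirchhoff G A (\<lambda>e. A e * c e + B e * s e) B (\<lambda>e. A e * s e - B e * c e)}"

definition det_manifold :: "('e::finite, 'v::finite) graph \<Rightarrow> (real ^ 'e) set" where
  "det_manifold G = {\<theta>. nullspace G \<theta> \<noteq> {0}}"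

definition det_manifold_reg :: "('e::finite, 'v::finite) graph \<Rightarrow> (real ^ 'e) set" where
  "det_manifold_reg G = {\<theta>. vec.dim (nullspace G \<theta>) = 1}"

text \<open>
  The Gauss map assigns to a regular point the ray spanned by \<open>coeff_energy X\<close> for a nonzero \<open>X\<close> in the
  nullspace. The vector below is the point of that ray on the hyperplane \<open>L \<bullet> q = 1\<close>; it does not
  depend on the choice of \<open>X\<close> (lemma \<open>normalized_gauss_map_eq\<close>).
\<close>

definition normalized_gauss_map ::
  "('e::finite, 'v::finite) graph \<Rightarrow> real ^ 'e \<Rightarrow> real ^ 'e \<Rightarrow> real ^ 'e" where
  "normalized_gauss_map G L \<theta> =
     (let g = coeff_energy (SOME X. X \<in> nullspace G \<theta> \<and> X \<noteq> 0) in (1 / (L \<bullet> g)) *\<^sub>R g)"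

definition generic_class :: "('e::finite, 'v::finite) graph \<Rightarrow> (real ^ 'e) set" where
  "generic_class G =
     {L. (\<forall>e. L $ e > 0) \<and>
         (\<forall>c :: 'e \<Rightarrow> rat. (\<Sum>e\<in>UNIV. of_rat (c e) * L $ e) = 0 \<longrightarrow> (\<forall>e. c e = 0)) \<and>
         (\<forall>k>0. k *\<^sub>R L \<notin> det_manifold G - det_manifold_reg G)}"

lemma nullspace_periodic:
  assumes "\<And>e. \<exists>m::int. \<theta>' $ e = \<theta> $ e + 2 * pi * of_int m"
  shows "nullspace G \<theta>' = nullspace G \<theta>"
proof -
  have "sin (\<theta>' $ e) = sin (\<theta> $ e) \<and> cos (\<theta>' $ e) = cos (\<theta> $ e)" for e
    using assms[of e] by (auto simp: sin_cos_eq_iff)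
  thus ?thesis by (simp add: nullspace_def)
qed

lemma subspace_nullspace: "vec.subspace (nullspace G \<theta>)"
proof (rule vec.subspaceI)
  show "0 \<in> nullspace G \<theta>"
    by (auto simp: nullspace_def kirchhoff_def)
next
  fix X Y assume "X \<in> nullspace G \<theta>" "Y \<in> nullspace G \<theta>"
  then obtain \<phi> \<psi> where
    X: "\<And>e. X $ Inl e = \<phi> (src G e)"
       "\<And>e. X $ Inl e * cos (\<theta> $ e) + X $ Inr e * sin (\<theta> $ e) = \<phi> (tgt G e)"
       "\<And>v. (\<Sum>e | src G e = v. X $ Inr e) +
             (\<Sum>e | tgt G e = v. X $ Inl e * sin (\<theta> $ e) - X $ Inr e * cos (\<theta> $ e)) = 0" and
    Y: "\<And>e. Y $ Inl e = \<psi> (src G e)"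
       "\<And>e. Y $ Inl e * cos (\<theta> $ e) + Y $ Inr e * sin (\<theta> $ e) = \<psi> (tgt G e)"
       "\<And>v. (\<Sum>e | src G e = v. Y $ Inr e) +
             (\<Sum>e | tgt G e = v. Y $ Inl e * sin (\<theta> $ e) - Y $ Inr e * cos (\<theta> $ e)) = 0"
    unfolding nullspace_def kirchhoff_def Let_def mem_Collect_eq by metis
  have "(\<Sum>e | src G e = v. X $ Inr e + Y $ Inr e) +
      (\<Sum>e | tgt G e = v. (X $ Inl e + Y $ Inl e) * sin (\<theta> $ e) - (X $ Inr e + Y $ Inr e) * cos (\<theta> $ e))
      = 0" for v
  proof -
    have "(\<Sum>e | src G e = v. X $ Inr e + Y $ Inr e) +
      (\<Sum>e | tgt G e = v. (X $ Inl e + Y $ Inl e) * sin (\<theta> $ e) - (X $ Inr e + Y $ Inr e) * cos (\<theta> $ e))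
      = ((\<Sum>e | src G e = v. X $ Inr e) +
             (\<Sum>e | tgt G e = v. X $ Inl e * sin (\<theta> $ e) - X $ Inr e * cos (\<theta> $ e))) +
        ((\<Sum>e | src G e = v. Y $ Inr e) +
             (\<Sum>e | tgt G e = v. Y $ Inl e * sin (\<theta> $ e) - Y $ Inr e * cos (\<theta> $ e)))"
      by (simp add: sum.distrib sum_subtractf algebra_simps)
    thus ?thesis using X(3) Y(3) by simp
  qed
  moreover have "\<exists>\<eta>. \<forall>e. X $ Inl e + Y $ Inl e = \<eta> (src G e) \<and>
      (X $ Inl e + Y $ Inl e) * cos (\<theta> $ e) + (X $ Inr e + Y $ Inr e) * sin (\<theta> $ e) = \<eta> (tgt G e)"
  proof (intro exI[of _ "\<lambda>v. \<phi> v + \<psi> v"] allI conjI)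
    fix e
    show "X $ Inl e + Y $ Inl e = \<phi> (src G e) + \<psi> (src G e)" using X(1) Y(1) by simp
    show "(X $ Inl e + Y $ Inl e) * cos (\<theta> $ e) + (X $ Inr e + Y $ Inr e) * sin (\<theta> $ e)
        = \<phi> (tgt G e) + \<psi> (tgt G e)"
      by (simp add: X(2)[symmetric] Y(2)[symmetric] algebra_simps)
  qed
  ultimately show "X + Y \<in> nullspace G \<theta>"
    by (simp add: nullspace_def kirchhoff_def)
next
  fix z X assume "X \<in> nullspace G \<theta>"
  then obtain \<phi> where
    X: "\<And>e. X $ Inl e = \<phi> (src G e)"
       "\<And>e. X $ Inl e * cos (\<theta> $ e) + X $ Inr e * sin (\<theta> $ e) = \<phi> (tgt G e)"
       "\<And>v. (\<Sum>e | src G e = v. X $ Inr e) +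
             (\<Sum>e | tgt G e = v. X $ Inl e * sin (\<theta> $ e) - X $ Inr e * cos (\<theta> $ e)) = 0"
    unfolding nullspace_def kirchhoff_def Let_def mem_Collect_eq by metis
  have "(\<Sum>e | src G e = v. z * X $ Inr e) +
      (\<Sum>e | tgt G e = v. z * X $ Inl e * sin (\<theta> $ e) - z * X $ Inr e * cos (\<theta> $ e)) = 0" for v
  proof -
    have "(\<Sum>e | src G e = v. z * X $ Inr e) +
      (\<Sum>e | tgt G e = v. z * X $ Inl e * sin (\<theta> $ e) - z * X $ Inr e * cos (\<theta> $ e))
      = z * ((\<Sum>e | src G e = v. X $ Inr e) +
             (\<Sum>e | tgt G e = v. X $ Inl e * sin (\<theta> $ e) - X $ Inr e * cos (\<theta> $ e)))"
      by (simp add: sum_distrib_left algebra_simps)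
    thus ?thesis using X(3) by simp
  qed
  moreover have "\<exists>\<eta>. \<forall>e. z * X $ Inl e = \<eta> (src G e) \<and>
      z * X $ Inl e * cos (\<theta> $ e) + z * X $ Inr e * sin (\<theta> $ e) = \<eta> (tgt G e)"
  proof (intro exI[of _ "\<lambda>v. z * \<phi> v"] allI conjI)
    fix e
    show "z * X $ Inl e = z * \<phi> (src G e)" using X(1) by simp
    show "z * X $ Inl e * cos (\<theta> $ e) + z * X $ Inr e * sin (\<theta> $ e) = z * \<phi> (tgt G e)"
      by (simp add: X(2)[symmetric] algebra_simps)
  qed
  ultimately show "z *s X \<in> nullspace G \<theta>"
    by (simp add: nullspace_def kirchhoff_def)
qed

lemma normalized_gauss_map_eq:
  assumes "\<theta> \<in> det_manifold_reg G" "X \<in> nullspace G \<theta>" "X \<noteq> 0"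
  shows "normalized_gauss_map G L \<theta> = (1 / (L \<bullet> coeff_energy X)) *\<^sub>R coeff_energy X"
proof -
  define Y where "Y = (SOME X. X \<in> nullspace G \<theta> \<and> X \<noteq> 0)"
  have Y: "Y \<in> nullspace G \<theta>" "Y \<noteq> 0"
    using someI[of "\<lambda>X. X \<in> nullspace G \<theta> \<and> X \<noteq> 0" X] assms unfolding Y_def by auto
  have "nullspace G \<theta> \<subseteq> vec.span {X}"
  proof (rule vec.card_ge_dim_independent)
    show "{X} \<subseteq> nullspace G \<theta>" using assms by simp
    show "vec.independent {X}" using assms by (simp add: vec.dependent_single)
    show "vec.dim (nullspace G \<theta>) \<le> card {X}"
      using assms by (simp add: det_manifold_reg_def)
  qed
  then obtain z where z: "Y = z *s X" using Y by (auto simp: vec.span_singleton)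
  have "z \<noteq> 0" using z Y by auto
  moreover have "coeff_energy Y = (cmod z)\<^sup>2 *\<^sub>R coeff_energy X"
    by (simp add: z coeff_energy_def vec_eq_iff norm_mult power_mult_distrib distrib_left)
  ultimately show ?thesis
    by (simp add: normalized_gauss_map_def Y_def[symmetric] Let_def)
qed

end

theory Submission
  imports Defs "HOL-Complex_Analysis.Complex_Analysis"
begin

text \<open>
  An eigenfunction of frequency \<open>k\<close> is the same as a vector of the nullspace at the phase \<open>k L\<close>
  (\<open>eigenfunction_has_coeffs\<close>, \<open>eigen_eq_wave\<close>), so the positive spectrum is the set of times at
  which the line \<open>k L\<close> lies on the determinant manifold, and the energy vector of the eigenfunction
  is, up to a factor, the Gauss map at that point. On each edge the intensity
  \<open>|u|\<^sup>2\<close> is its mean \<open>q\<^sub>e\<close> plus a term oscillating with frequency \<open>2 k\<close> and of amplitude at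
  most \<open>q\<^sub>e\<close>. By the Riemann--Lebesgue lemma the mass in \<open>\<omega>\<close> is therefore
  \<open>\<alpha> \<bullet> q\<close> up to a relative error that tends to zero as \<open>k\<close> grows
  (\<open>mass_estimate\<close>). For the whole
  graph this says that \<open>L \<bullet> q\<close> tends to \<open>1\<close> under normalization, which fixes the factor in the
  limit. Hence all limits of energy vectors lie in the closure of the Gauss image.

  Conversely, let \<open>z\<close> be a regular point. The phase line comes arbitrarily close to \<open>z\<close> modulo the
  period lattice at arbitrarily large times, by the theorems of Kronecker and Dirichlet. To reach
  the determinant manifold itself one may still change the time a little. That this suffices is a
  complex-analytic fact: along every line in direction \<open>L\<close> the secular determinant
  is an entire function of the time all of whose zeros are real, because a nonreal time would create
  a flux of one sign on all edges, contradicting the balance at the vertices. Such a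
  zero persists on neighbouring lines by Hurwitz's theorem
  (\<open>det_manifold_meets_nearby_lines\<close>).
  Genericity of the metric makes the points reached regular, and the Gauss map is continuous along
  them by compactness of the unit sphere and closedness of the nullspace condition. So every value
  of the Gauss map is attainable, and a diagonal choice yields the closure.

  The closure is a compact subset of the simplex \<open>L \<bullet> q = 1\<close>, so the functional \<open>\<alpha> \<bullet> q\<close> has a
  minimum on it; the mass estimate, which is uniform in the eigenfunction, identifies this minimum with
  the limit of the infima.
\<close>

\<comment> \<open>\<open>$\<close> denotes components of vectors throughout\<close>
no_notation fps_nth (infixl \<open>$\<close> 75)

lemma LIMSEQ_if_dist_less_inverse:
  assumes "\<And>n. dist (X n) z < 1 / real (Suc n)"
  shows "X \<longlonglongrightarrow> z"
proof -
  have "(\<lambda>n. dist (X n) z) \<longlonglongrightarrow> 0"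
    by (rule tendsto_sandwich[OF _ _ tendsto_const LIMSEQ_inverse_real_of_nat])
       (use assms in \<open>auto simp: inverse_eq_divide less_imp_le\<close>)
  thus ?thesis by (rule iffD2[OF tendsto_dist_iff])
qed

section \<open>The secular determinant\<close>

definition isolated_vertex :: "('e::finite, 'v::finite) graph \<Rightarrow> 'v \<Rightarrow> bool" where
  "isolated_vertex G v \<longleftrightarrow> (\<forall>e. src G e \<noteq> v \<and> tgt G e \<noteq> v)"

text \<open>
  Coefficients and vertex values together satisfy as many equations as there are unknowns:
  continuity at the two ends of each edge, and one balance of derivatives per vertex. So a
  determinant detects nontrivial solutions, also at complex phases \<open>\<zeta>\<close>. No edge constrains the
  value at an isolated vertex; its balance equation, which is void, is replaced by the equation
  that this value vanishes, as otherwise the determinant would be identically zero.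
\<close>

definition secular_map ::
  "('e::finite, 'v::finite) graph \<Rightarrow> ('e \<Rightarrow> complex) \<Rightarrow>
     complex ^ (('e + 'e) + 'v) \<Rightarrow> complex ^ (('e + 'e) + 'v)" where
  "secular_map G \<zeta> Y = (\<chi> i. case i of
       Inl (Inl e) \<Rightarrow> Y $ Inl (Inl e) - Y $ Inr (src G e)
     | Inl (Inr e) \<Rightarrow> Y $ Inl (Inl e) * cos (\<zeta> e) + Y $ Inl (Inr e) * sin (\<zeta> e) - Y $ Inr (tgt G e)
     | Inr v \<Rightarrow> (\<Sum>e | src G e = v. Y $ Inl (Inr e)) +
         (\<Sum>e | tgt G e = v. Y $ Inl (Inl e) * sin (\<zeta> e) - Y $ Inl (Inr e) * cos (\<zeta> e)) +
         (if isolated_vertex G v then Y $ Inr v else 0))"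

definition secular_det :: "('e::finite, 'v::finite) graph \<Rightarrow> ('e \<Rightarrow> complex) \<Rightarrow> complex" where
  "secular_det G \<zeta> = det (matrix (secular_map G \<zeta>))"

lemma linear_secular_map: "Vector_Spaces.linear (*s) (*s) (secular_map G \<zeta>)"
proof (unfold_locales, goal_cases)
  case (1 X Y)
  show ?case
    by (auto simp: vec_eq_iff secular_map_def sum.distrib sum_subtractf algebra_simps
        split: sum.splits)
next
  case (2 z X)
  show ?case
    by (auto simp: vec_eq_iff secular_map_def sum_distrib_left sum_subtractf algebra_simps
        split: sum.splits)
qed

lemma secular_det_eq_0_iff:
  "secular_det G \<zeta> = 0 \<longleftrightarrow> (\<exists>Y. Y \<noteq> 0 \<and> secular_map G \<zeta> Y = 0)"
proof -
  have "secular_det G \<zeta> \<noteq> 0 \<longleftrightarrow> (\<forall>Y. matrix (secular_map G \<zeta>) *v Y = 0 \<longrightarrow> Y = 0)"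
    unfolding secular_det_def invertible_det_nz[symmetric] invertible_left_inverse
      matrix_left_invertible_ker ..
  thus ?thesis
    by (auto simp: matrix_works[OF linear_secular_map])
qed

lemma wave_flux: "Im (cnj (p + q) * (\<i> * (p - q))) = (cmod p)\<^sup>2 - (cmod q)\<^sup>2"
  unfolding cmod_power2 by (simp add: algebra_simps power2_eq_square)

text \<open>
  In the basis of travelling waves the flux \<open>Im (cnj u * u')\<close> is diagonal, and moving by a complex
  phase rescales the two waves by reciprocal factors. The two sides of \<open>wave_flux\<close> at both
  ends thus give the net flux from the two ends into an edge.
\<close>

lemma edge_flux:
  fixes A B \<zeta> :: complex
  defines "a \<equiv> (A - \<i> * B) / 2" and "b \<equiv> (A + \<i> * B) / 2"
  shows "Im (cnj A * B + cnj (A * cos \<zeta> + B * sin \<zeta>) * (A * sin \<zeta> - B * cos \<zeta>)) =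
    (cmod a)\<^sup>2 * (1 - exp (- 2 * Im \<zeta>)) - (cmod b)\<^sup>2 * (1 - exp (2 * Im \<zeta>))"
proof -
  define p where "p = a * exp (\<i> * \<zeta>)"
  define q where "q = b * exp (- (\<i> * \<zeta>))"
  have A: "A = a + b" and B: "B = \<i> * (a - b)"
    by (auto simp: a_def b_def field_simps)
  have p: "A * cos \<zeta> + B * sin \<zeta> = p + q"
    unfolding p_def q_def A B cos_exp_eq sin_exp_eq by (simp add: field_simps)
  have q: "A * sin \<zeta> - B * cos \<zeta> = - (\<i> * (p - q))"
    unfolding p_def q_def A B cos_exp_eq sin_exp_eq by (simp add: field_simps)
  have np: "(cmod p)\<^sup>2 = (cmod a)\<^sup>2 * exp (- 2 * Im \<zeta>)"
    by (simp add: p_def norm_mult power_mult_distrib exp_double[symmetric] mult.commute)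
  have nq: "(cmod q)\<^sup>2 = (cmod b)\<^sup>2 * exp (2 * Im \<zeta>)"
    by (simp add: q_def norm_mult power_mult_distrib exp_double[symmetric] mult.commute)
  have "Im (cnj A * B + cnj (A * cos \<zeta> + B * sin \<zeta>) * (A * sin \<zeta> - B * cos \<zeta>)) =
      Im (cnj (a + b) * (\<i> * (a - b))) - Im (cnj (p + q) * (\<i> * (p - q)))"
    unfolding p q unfolding A B by simp
  thus ?thesis unfolding wave_flux np nq by (simp add: algebra_simps)
qed

text \<open>
  If all phases have imaginary parts of the same sign, then by \<open>edge_flux\<close> every edge carrying a
  nonzero wave contributes a net flux of one and the same strict sign, whereas the Kirchhoff
  condition makes the sum of these fluxes, grouped by vertices, vanish.
\<close>

lemma secular_map_kernel_trivial:
  fixes G :: "('e::finite, 'v::finite) graph"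
  assumes ker: "secular_map G \<zeta> Y = 0"
    and sgn: "(\<forall>e. Im (\<zeta> e) > 0) \<or> (\<forall>e. Im (\<zeta> e) < 0)"
  shows "Y = 0"
proof -
  define A where "A e = Y $ Inl (Inl e)" for e
  define B where "B e = Y $ Inl (Inr e)" for e
  define \<phi> where "\<phi> v = Y $ Inr v" for v
  define D where "D e = A e * sin (\<zeta> e) - B e * cos (\<zeta> e)" for e
  have eq: "secular_map G \<zeta> Y $ i = 0" for i using ker by simp
  have s: "A e = \<phi> (src G e)" for e
    using eq[of "Inl (Inl e)"] by (simp add: secular_map_def A_def \<phi>_def)
  have t: "A e * cos (\<zeta> e) + B e * sin (\<zeta> e) = \<phi> (tgt G e)" for e
    using eq[of "Inl (Inr e)"] by (simp add: secular_map_def A_def B_def \<phi>_def)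
  have v: "(\<Sum>e | src G e = v. B e) + (\<Sum>e | tgt G e = v. D e) +
      (if isolated_vertex G v then \<phi> v else 0) = 0" for v
    using eq[of "Inr v"] unfolding secular_map_def by (simp add: A_def B_def D_def \<phi>_def cong: if_cong split del: if_split)
  have v': "(\<Sum>e | src G e = v. B e) + (\<Sum>e | tgt G e = v. D e) = 0" for v
  proof (cases "isolated_vertex G v")
    case True
    hence "{e. src G e = v} = {}" "{e. tgt G e = v} = {}" by (auto simp: isolated_vertex_def)
    thus ?thesis by simp
  qed (use v[of v] in simp)
  have 1: "(\<Sum>v\<in>UNIV. cnj (\<phi> v) * (\<Sum>e | src G e = v. B e)) = (\<Sum>e\<in>UNIV. cnj (A e) * B e)"
  proof -
    have "(\<Sum>e\<in>UNIV. cnj (A e) * B e) =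
        (\<Sum>v\<in>UNIV. \<Sum>e | e \<in> UNIV \<and> src G e = v. cnj (A e) * B e)"
      by (rule sum.group[symmetric]) auto
    also have "\<dots> = (\<Sum>v\<in>UNIV. cnj (\<phi> v) * (\<Sum>e | src G e = v. B e))"
      by (intro sum.cong refl) (auto simp: sum_distrib_left s)
    finally show ?thesis ..
  qed
  have 2: "(\<Sum>v\<in>UNIV. cnj (\<phi> v) * (\<Sum>e | tgt G e = v. D e)) =
      (\<Sum>e\<in>UNIV. cnj (A e * cos (\<zeta> e) + B e * sin (\<zeta> e)) * D e)"
  proof -
    have "(\<Sum>e\<in>UNIV. cnj (A e * cos (\<zeta> e) + B e * sin (\<zeta> e)) * D e) =
        (\<Sum>v\<in>UNIV. \<Sum>e | e \<in> UNIV \<and> tgt G e = v. cnj (A e * cos (\<zeta> e) + B e * sin (\<zeta> e)) * D e)"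
      by (rule sum.group[symmetric]) auto
    also have "\<dots> = (\<Sum>v\<in>UNIV. cnj (\<phi> v) * (\<Sum>e | tgt G e = v. D e))"
      by (intro sum.cong refl) (auto simp: sum_distrib_left t)
    finally show ?thesis ..
  qed
  \<comment> \<open>the amplitudes of the waves travelling forwards and backwards\<close>
  define a where "a e = (A e - \<i> * B e) / 2" for e
  define b where "b e = (A e + \<i> * B e) / 2" for e
  define F where "F e = (cmod (a e))\<^sup>2 * (1 - exp (- 2 * Im (\<zeta> e))) -
      (cmod (b e))\<^sup>2 * (1 - exp (2 * Im (\<zeta> e)))" for e
  have "(\<Sum>e\<in>UNIV. cnj (A e) * B e) +
      (\<Sum>e\<in>UNIV. cnj (A e * cos (\<zeta> e) + B e * sin (\<zeta> e)) * D e) = 0"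
    unfolding 1[symmetric] 2[symmetric] sum.distrib[symmetric] distrib_left[symmetric] v' by simp
  hence "(\<Sum>e\<in>UNIV. Im (cnj (A e) * B e + cnj (A e * cos (\<zeta> e) + B e * sin (\<zeta> e)) * D e)) = 0"
    unfolding sum.distrib[symmetric] Im_sum[symmetric] by simp
  hence F0: "(\<Sum>e\<in>UNIV. F e) = 0"
    unfolding D_def edge_flux F_def a_def b_def .
  have ab: "a e = 0 \<and> b e = 0" for e
    using sgn
  proof
    assume pos: "\<forall>e. Im (\<zeta> e) > 0"
    have nn: "(cmod (a e))\<^sup>2 * (1 - exp (- 2 * Im (\<zeta> e))) \<ge> 0"
      "(cmod (b e))\<^sup>2 * (1 - exp (2 * Im (\<zeta> e))) \<le> 0" for e
      using pos[rule_format, of e] by (auto simp: mult_le_0_iff)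
    have "F e = 0"
      using F0 by (subst (asm) sum_nonneg_eq_0_iff) (use nn in \<open>auto simp: F_def intro: order_trans\<close>)
    hence "(cmod (a e))\<^sup>2 * (1 - exp (- 2 * Im (\<zeta> e))) = 0"
      "(cmod (b e))\<^sup>2 * (1 - exp (2 * Im (\<zeta> e))) = 0"
      using nn[of e] unfolding F_def by linarith+
    thus ?thesis using pos[rule_format, of e] by auto
  next
    assume neg: "\<forall>e. Im (\<zeta> e) < 0"
    have nn: "(cmod (a e))\<^sup>2 * (1 - exp (- 2 * Im (\<zeta> e))) \<le> 0"
      "(cmod (b e))\<^sup>2 * (1 - exp (2 * Im (\<zeta> e))) \<ge> 0" for e
      using neg[rule_format, of e] by (auto simp: mult_le_0_iff)
    have "(\<Sum>e\<in>UNIV. - F e) = 0" using F0 by (simp add: sum_negf)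
    hence "- F e = 0"
      by (subst (asm) sum_nonneg_eq_0_iff) (use nn in \<open>auto simp: F_def intro: order_trans\<close>)
    hence "(cmod (a e))\<^sup>2 * (1 - exp (- 2 * Im (\<zeta> e))) = 0"
      "(cmod (b e))\<^sup>2 * (1 - exp (2 * Im (\<zeta> e))) = 0"
      using nn[of e] unfolding F_def by linarith+
    thus ?thesis using neg[rule_format, of e] by auto
  qed
  have AB: "A e = 0 \<and> B e = 0" for e
  proof -
    have "A e = a e + b e" "B e = \<i> * (a e - b e)" by (auto simp: a_def b_def field_simps)
    thus ?thesis using ab by simp
  qed
  have "\<phi> v = 0" for v
  proof (cases "isolated_vertex G v")
    case True
    thus ?thesis using v[of v] v'[of v] by simp
  next
    case False
    then obtain e where "src G e = v \<or> tgt G e = v" by (auto simp: isolated_vertex_def)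
    thus ?thesis using s[of e] t[of e] AB[of e] by auto
  qed
  thus "Y = 0"
    using AB unfolding A_def B_def \<phi>_def vec_eq_iff
    by (metis sum.exhaust zero_index)
qed

lemma det_manifold_iff_secular_det:
  "\<theta> \<in> det_manifold G \<longleftrightarrow> secular_det G (\<lambda>e. complex_of_real (\<theta> $ e)) = 0"
proof
  let ?\<zeta> = "\<lambda>e. complex_of_real (\<theta> $ e)"
  assume "\<theta> \<in> det_manifold G"
  moreover have "0 \<in> nullspace G \<theta>" using subspace_nullspace vec.subspace_0 by blast
  ultimately obtain X where X: "X \<in> nullspace G \<theta>" "X \<noteq> 0"
    unfolding det_manifold_def by blast
  then obtain \<phi> where
    X1: "\<And>e. X $ Inl e = \<phi> (src G e)"
       "\<And>e. X $ Inl e * cos (\<theta> $ e) + X $ Inr e * sin (\<theta> $ e) = \<phi> (tgt G e)"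
       "\<And>v. (\<Sum>e | src G e = v. X $ Inr e) +
             (\<Sum>e | tgt G e = v. X $ Inl e * sin (\<theta> $ e) - X $ Inr e * cos (\<theta> $ e)) = 0"
    unfolding nullspace_def kirchhoff_def Let_def mem_Collect_eq by metis
  define Y :: "complex ^ (('a + 'a) + 'b)" where
    "Y = (\<chi> i. case i of Inl j \<Rightarrow> X $ j | Inr v \<Rightarrow> if isolated_vertex G v then 0 else \<phi> v)"
  have Y: "Y $ Inl j = X $ j" "Y $ Inr v = (if isolated_vertex G v then 0 else \<phi> v)" for j v
    by (simp_all add: Y_def)
  have ni: "\<not> isolated_vertex G (src G e)" "\<not> isolated_vertex G (tgt G e)" for e
    by (auto simp: isolated_vertex_def)
  have "secular_map G ?\<zeta> Y = 0"
    unfolding vec_eq_iff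
  proof
    fix i
    show "secular_map G ?\<zeta> Y $ i = 0 $ i"
      using X1(1) X1(3) unfolding secular_map_def
      by (auto simp: Y ni X1(2)[symmetric] cos_of_real sin_of_real split: sum.splits)
  qed
  moreover have "Y \<noteq> 0"
    using X(2) Y(1) by (metis vec_eq_iff zero_index)
  ultimately show "secular_det G ?\<zeta> = 0" using secular_det_eq_0_iff by blast
next
  let ?\<zeta> = "\<lambda>e. complex_of_real (\<theta> $ e)"
  assume "secular_det G ?\<zeta> = 0"
  then obtain Y where Y0: "Y \<noteq> 0" and ker: "secular_map G ?\<zeta> Y = 0"
    using secular_det_eq_0_iff by blast
  define X :: "'a coeffs" where "X = (\<chi> j. Y $ Inl j)"
  define \<phi> where "\<phi> v = Y $ Inr v" for v
  have X: "Y $ Inl j = X $ j" for j by (simp add: X_def)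
  have eq: "secular_map G ?\<zeta> Y $ i = 0" for i using ker by simp
  have s: "X $ Inl e = \<phi> (src G e)" for e
    using eq[of "Inl (Inl e)"] by (simp add: secular_map_def X \<phi>_def)
  have t: "X $ Inl e * cos (\<theta> $ e) + X $ Inr e * sin (\<theta> $ e) = \<phi> (tgt G e)" for e
    using eq[of "Inl (Inr e)"] by (simp add: secular_map_def X \<phi>_def cos_of_real sin_of_real)
  have v: "(\<Sum>e | src G e = v. X $ Inr e) +
        (\<Sum>e | tgt G e = v. X $ Inl e * sin (\<theta> $ e) - X $ Inr e * cos (\<theta> $ e)) +
      (if isolated_vertex G v then \<phi> v else 0) = 0" for v
    using eq[of "Inr v"] unfolding secular_map_def
    by (simp add: X \<phi>_def cos_of_real sin_of_real cong: if_cong split del: if_split)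
  have iso: "{e. src G e = v} = {}" "{e. tgt G e = v} = {}" if "isolated_vertex G v" for v
    using that by (auto simp: isolated_vertex_def)
  have v': "(\<Sum>e | src G e = v. X $ Inr e) +
        (\<Sum>e | tgt G e = v. X $ Inl e * sin (\<theta> $ e) - X $ Inr e * cos (\<theta> $ e)) = 0" for v
    using v[of v] iso[of v] by (cases "isolated_vertex G v") simp_all
  have "X \<in> nullspace G \<theta>"
    unfolding nullspace_def kirchhoff_def Let_def mem_Collect_eq
    using s t v' by blast
  moreover have "X \<noteq> 0"
  proof
    assume X0: "X = 0"
    have "\<phi> v = 0" for v
    proof (cases "isolated_vertex G v")
      case True
      thus ?thesis using v[of v] v'[of v] by simp
    next
      case False
      then obtain e where "src G e = v \<or> tgt G e = v" by (auto simp: isolated_vertex_def)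
      thus ?thesis using s[of e] t[of e] X0 by auto
    qed
    hence "Y = 0"
      using X X0 unfolding \<phi>_def vec_eq_iff
      by (metis sum.exhaust zero_index)
    thus False using Y0 by simp
  qed
  ultimately show "\<theta> \<in> det_manifold G" unfolding det_manifold_def by blast
qed

section \<open>Lines in the direction of the metric cross the determinant manifold stably\<close>

lemma secular_det_continuous_on:
  fixes \<zeta> :: "'a::t2_space \<Rightarrow> 'e::finite \<Rightarrow> complex"
  assumes "\<And>e. continuous_on S (\<lambda>x. \<zeta> x e)"
  shows "continuous_on S (\<lambda>x. secular_det G (\<zeta> x))"
  unfolding secular_det_def det_def
proof (intro continuous_on_sum continuous_on_mult continuous_on_const continuous_on_prod)
  fix \<pi> i
  show "continuous_on S (\<lambda>x. matrix (secular_map G (\<zeta> x)) $ i $ \<pi> i)"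
  proof -
    consider e where "i = Inl (Inl e)" | e where "i = Inl (Inr e)" | v where "i = Inr v"
      by (metis sum.exhaust)
    thus ?thesis
      unfolding matrix_def secular_map_def
      by cases (auto intro!: continuous_intros assms)
  qed
qed

lemma secular_det_holomorphic_on:
  assumes "\<And>e. (\<lambda>t. \<zeta> t e) holomorphic_on S"
  shows "(\<lambda>t. secular_det G (\<zeta> t)) holomorphic_on S"
  unfolding secular_det_def det_def
proof (intro holomorphic_intros)
  fix \<pi> i
  show "(\<lambda>t. matrix (secular_map G (\<zeta> t)) $ i $ \<pi> i) holomorphic_on S"
  proof -
    consider e where "i = Inl (Inl e)" | e where "i = Inl (Inr e)" | v where "i = Inr v"
      by (metis sum.exhaust)
    thus ?thesis
      unfolding matrix_def secular_map_def
      by cases (auto intro!: holomorphic_intros assms)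
  qed
qed

definition secular_line ::
  "('e::finite, 'v::finite) graph \<Rightarrow> real ^ 'e \<Rightarrow> real ^ 'e \<Rightarrow> complex \<Rightarrow> complex" where
  "secular_line G L \<theta> t = secular_det G (\<lambda>e. complex_of_real (\<theta> $ e) + t * complex_of_real (L $ e))"

lemma secular_line_zero_real:
  assumes "\<And>e. L $ e > 0" "secular_line G L \<theta> t = 0"
  shows "t \<in> \<real>"
proof (rule ccontr)
  assume "t \<notin> \<real>"
  hence "Im t > 0 \<or> Im t < 0" by (auto simp: complex_is_Real_iff)
  hence "(\<forall>e. Im (complex_of_real (\<theta> $ e) + t * complex_of_real (L $ e)) > 0) \<or>
     (\<forall>e. Im (complex_of_real (\<theta> $ e) + t * complex_of_real (L $ e)) < 0)"
    using assms(1) by (auto simp: mult_neg_pos)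
  moreover obtain Y where "Y \<noteq> 0"
    "secular_map G (\<lambda>e. complex_of_real (\<theta> $ e) + t * complex_of_real (L $ e)) Y = 0"
    using assms(2) unfolding secular_line_def secular_det_eq_0_iff by blast
  ultimately show False using secular_map_kernel_trivial by blast
qed

lemma secular_line_of_real:
  "secular_line G L \<theta> (complex_of_real t) = 0 \<longleftrightarrow> \<theta> + t *\<^sub>R L \<in> det_manifold G"
  by (simp add: secular_line_def det_manifold_iff_secular_det)

text \<open>
  Along the line through \<open>z\<close> in direction \<open>L\<close> the secular determinant is entire, vanishes at the
  parameter \<open>0\<close>, and does not vanish off the real axis, so it is not constant. Hurwitz's theorem
  forces determinants along nearby lines to have zeros near \<open>0\<close>, and these zeros are again
  real. The case \<open>dim N(z) > 1\<close>, where an implicit function argument would fail, is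
  included; it is needed for \<open>z = 0\<close>.
\<close>

proposition det_manifold_meets_nearby_lines:
  fixes G :: "('e::finite, 'v::finite) graph"
  assumes L: "\<And>e. L $ e > 0" and z: "z \<in> det_manifold G" and "\<epsilon> > 0"
  obtains \<delta> where "\<delta> > 0"
    "\<And>\<theta>. dist \<theta> z < \<delta> \<Longrightarrow> \<exists>t. \<bar>t\<bar> < \<epsilon> \<and> \<theta> + t *\<^sub>R L \<in> det_manifold G"
proof (rule ccontr)
  assume "\<not> thesis"
  hence "\<forall>\<delta>>0. \<exists>\<theta>. dist \<theta> z < \<delta> \<and> (\<forall>t. \<bar>t\<bar> < \<epsilon> \<longrightarrow> \<theta> + t *\<^sub>R L \<notin> det_manifold G)"
    using that by blast
  hence "\<forall>n. \<exists>\<theta>. dist \<theta> z < 1 / real (Suc n) \<and>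
      (\<forall>t. \<bar>t\<bar> < \<epsilon> \<longrightarrow> \<theta> + t *\<^sub>R L \<notin> det_manifold G)"
    by simp
  then obtain \<theta> where \<theta>: "\<And>n. dist (\<theta> n) z < 1 / real (Suc n)"
    "\<And>n t. \<bar>t\<bar> < \<epsilon> \<Longrightarrow> \<theta> n + t *\<^sub>R L \<notin> det_manifold G"
    by metis
  have lim: "\<theta> \<longlonglongrightarrow> z" by (rule LIMSEQ_if_dist_less_inverse) (rule \<theta>(1))
  have hol: "secular_line G L \<theta>' holomorphic_on S" for \<theta>' S
    unfolding secular_line_def by (intro secular_det_holomorphic_on holomorphic_intros)
  have cont: "continuous_on S (\<lambda>(x, t). secular_line G L x t)" for S
    unfolding secular_line_def split_def
    by (intro secular_det_continuous_on continuous_intros)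
  have "secular_line G L z 0 \<noteq> 0"
  proof (rule Hurwitz_no_zeros[of "ball 0 \<epsilon>" "\<lambda>n. secular_line G L (\<theta> n)" "secular_line G L z" 0])
    show "uniform_limit K (\<lambda>n. secular_line G L (\<theta> n)) (secular_line G L z) sequentially"
      if "compact K" "K \<subseteq> ball 0 \<epsilon>" for K
    proof (rule uniform_limitI)
      fix r :: real assume "r > 0"
      have "uniformly_continuous_on (cball z 1 \<times> K) (\<lambda>(x, t). secular_line G L x t)"
        by (intro compact_uniformly_continuous cont compact_Times compact_cball that)
      then obtain d where d: "d > 0" "\<And>p p'. p \<in> cball z 1 \<times> K \<Longrightarrow> p' \<in> cball z 1 \<times> K \<Longrightarrow>
          dist p' p < d \<Longrightarrow> dist ((\<lambda>(x, t). secular_line G L x t) p') ((\<lambda>(x, t). secular_line G L x t) p) < r"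
        using \<open>r > 0\<close> unfolding uniformly_continuous_on_def by metis
      have "\<forall>\<^sub>F n in sequentially. dist (\<theta> n) z < min d 1"
        using tendstoD[OF lim, of "min d 1"] d(1) by simp
      thus "\<forall>\<^sub>F n in sequentially. \<forall>t\<in>K. dist (secular_line G L (\<theta> n) t) (secular_line G L z t) < r"
      proof eventually_elim
        case (elim n)
        show ?case
        proof
          fix t assume "t \<in> K"
          thus "dist (secular_line G L (\<theta> n) t) (secular_line G L z t) < r"
            using d(2)[of "(z, t)" "(\<theta> n, t)"] elim
            by (auto simp: dist_Pair_Pair dist_commute)
        qed
      qed
    qed
    show "\<not> secular_line G L z constant_on ball 0 \<epsilon>"
    proof
      assume "secular_line G L z constant_on ball 0 \<epsilon>"
      then obtain c where c: "\<And>t. t \<in> ball 0 \<epsilon> \<Longrightarrow> secular_line G L z t = c"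
        by (auto simp: constant_on_def)
      have "secular_line G L z 0 = 0"
        using z secular_line_of_real[of G L z 0] by simp
      hence "secular_line G L z (\<i> * of_real (\<epsilon> / 2)) = 0"
        using c[of 0] c[of "\<i> * of_real (\<epsilon> / 2)"] \<open>\<epsilon> > 0\<close> by (simp add: norm_mult)
      from secular_line_zero_real[OF L this] show False
        using \<open>\<epsilon> > 0\<close> by (simp add: complex_is_Real_iff)
    qed
    show "secular_line G L (\<theta> n) t \<noteq> 0" if "t \<in> ball 0 \<epsilon>" for n t
    proof
      assume 0: "secular_line G L (\<theta> n) t = 0"
      then obtain s where s: "t = complex_of_real s"
        using secular_line_zero_real[OF L 0] by (auto elim: Reals_cases)
      have "\<theta> n + s *\<^sub>R L \<in> det_manifold G"
        using 0 unfolding s secular_line_of_real .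
      thus False using \<theta>(2)[of s n] that s by simp
    qed
  qed (use hol \<open>\<epsilon> > 0\<close> in auto)
  thus False using z secular_line_of_real[of G L z 0] by simp
qed

section \<open>The phase line modulo the period lattice\<close>

text \<open>The form in which Kronecker's theorem asks for rational independence: an enumerated
  family, linearly independent over the integers.\<close>

lemma rationally_independent_imp_int_independent:
  fixes L :: "real ^ 'e::finite"
  assumes "\<forall>c :: 'e \<Rightarrow> rat. (\<Sum>e\<in>UNIV. of_rat (c e) * L $ e) = 0 \<longrightarrow> (\<forall>e. c e = 0)"
    and f: "bij_betw f {..<n} (UNIV :: 'e set)" and "d \<noteq> 0"
  shows "inj_on (\<lambda>i. L $ f i / d) {..<n}"
    "module.independent (\<lambda>r. (*) (real_of_int r)) ((\<lambda>i. L $ f i / d) ` {..<n})"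
proof -
  have rat_indep: "c e = 0" if "(\<Sum>e\<in>UNIV. of_rat (c e) * L $ e) = 0" for c :: "'e \<Rightarrow> rat" and e
    using assms(1) that by blast
  have inj_L: "inj (\<lambda>e. L $ e)"
  proof (rule injI, rule ccontr)
    fix e e' assume eq: "L $ e = L $ e'" and ne: "e \<noteq> e'"
    define c :: "'e \<Rightarrow> rat" where "c x = of_bool (x = e) - of_bool (x = e')" for x
    have "(\<Sum>x\<in>UNIV. of_rat (c x) * L $ x) = (\<Sum>x\<in>UNIV. of_bool (x = e) * L $ x) - (\<Sum>x\<in>UNIV. of_bool (x = e') * L $ x)"
      unfolding sum_subtractf[symmetric] by (intro sum.cong) (auto simp: c_def of_rat_diff)
    also have "\<dots> = 0" using eq by (simp add: of_bool_def if_distrib[of "\<lambda>x. x * _"] cong: if_cong)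
    finally show False using rat_indep[of c e] ne by (simp add: c_def)
  qed
  define g where "g e = L $ e / d" for e
  have inj_g: "inj g" using inj_L \<open>d \<noteq> 0\<close> by (auto simp: g_def inj_def)
  have im: "(\<lambda>i. L $ f i / d) = g \<circ> f" by (auto simp: g_def)
  show inj: "inj_on (\<lambda>i. L $ f i / d) {..<n}"
    unfolding im using f inj_g by (metis bij_betw_def comp_inj_on inj_on_subset subset_UNIV)
  have img: "(\<lambda>i. L $ f i / d) ` {..<n} = range g"
    unfolding im image_comp[symmetric] using f by (simp add: bij_betw_def)
  interpret Modules.module "(\<lambda>r. (*) (real_of_int r))"
    by (simp add: Modules.module.intro distrib_left mult.commute)
  show "independent ((\<lambda>i. L $ f i / d) ` {..<n})"
    unfolding img dependent_finite[OF finite_imageI[OF finite]]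
  proof clarify
    fix h e assume h: "(\<Sum>x\<in>range g. real_of_int (h x) * x) = 0" and ne: "h (g e) \<noteq> 0"
    have "(\<Sum>e\<in>UNIV. real_of_int (h (g e)) * g e) = 0"
      using h by (subst (asm) sum.reindex[OF inj_g]) simp
    hence "(\<Sum>e\<in>UNIV. real_of_int (h (g e)) * L $ e) = 0"
      using \<open>d \<noteq> 0\<close> by (simp add: g_def sum_divide_distrib[symmetric])
    hence "(\<Sum>e\<in>UNIV. of_rat (of_int (h (g e))) * L $ e) = 0" by simp
    hence "(of_int (h (g e)) :: rat) = 0" by (rule rat_indep)
    thus False using ne by simp
  qed
qed

text \<open>
  Kronecker's theorem gives some time \<open>t\<close> at which the phases are close to \<open>z\<close>, without control
  of \<open>t\<close>. Adding a large time at which all phases are nearly \<open>0\<close>, supplied by Dirichlet's theorem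
  on simultaneous approximation, moves \<open>t\<close> beyond any bound.
\<close>

proposition phase_line_recurrently_dense:
  fixes L :: "real ^ 'e::finite"
  assumes "\<forall>c :: 'e \<Rightarrow> rat. (\<Sum>e\<in>UNIV. of_rat (c e) * L $ e) = 0 \<longrightarrow> (\<forall>e. c e = 0)"
    and "\<epsilon> > 0"
  obtains k m where "k > K" "\<And>e. \<bar>k * L $ e - z $ e - 2 * pi * of_int (m e)\<bar> < \<epsilon>"
proof -
  obtain f where f: "bij_betw f {..<CARD('e)} (UNIV :: 'e set)"
    using ex_bij_betw_nat_finite[of "UNIV :: 'e set"] by (auto simp: atLeast0LessThan)
  define \<eta> where "\<eta> = \<epsilon> / (4 * pi)"
  have \<eta>: "\<eta> > 0" using \<open>\<epsilon> > 0\<close> by (simp add: \<eta>_def)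
  obtain t h where th: "\<And>i. i < CARD('e) \<Longrightarrow>
      \<bar>t * (L $ f i / (2 * pi)) - of_int (h i) - z $ f i / (2 * pi)\<bar> < \<eta>"
    using Kronecker_thm_1[OF rationally_independent_imp_int_independent(2)[OF assms(1) f]
      rationally_independent_imp_int_independent(1)[OF assms(1) f] \<eta>,
      of "2 * pi" "\<lambda>i. z $ f i / (2 * pi)"] by auto
  \<comment> \<open>every positive integer multiple of \<open>T\<close>, added to \<open>t\<close>, exceeds \<open>K\<close>\<close>
  define T where "T = max 1 (K - t + 1)"
  obtain N where N: "N > 0" "1 / real N < \<eta>"
    using \<eta> nat_approx_posE[of \<eta>] by (metis zero_less_Suc)
  obtain q p where q: "0 < (q :: int)"
    and p: "\<And>i. i < CARD('e) \<Longrightarrow> \<bar>of_int q * (T * L $ f i / (2 * pi)) - of_int (p i)\<bar> < 1 / N"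
    using Dirichlet_approx_simult[OF N(1), of "CARD('e)" "\<lambda>i. T * L $ f i / (2 * pi)"] by metis
  define k where "k = t + of_int q * T"
  define g where "g = inv_into {..<CARD('e)} f"
  have g: "g e < CARD('e)" "f (g e) = e" for e
    using f by (auto simp: g_def bij_betw_def f_inv_into_f) 
      (metis UNIV_I inv_into_into lessThan_iff)
  have "1 * T \<le> of_int q * T" using q by (intro mult_right_mono) (auto simp: T_def)
  hence "k > K" by (simp add: k_def T_def)
  moreover have "\<bar>k * L $ e - z $ e - 2 * pi * of_int (h (g e) + p (g e))\<bar> < \<epsilon>" for e
  proof -
    define x where "x = t * (L $ e / (2 * pi)) - of_int (h (g e)) - z $ e / (2 * pi)"
    define y where "y = of_int q * (T * L $ e / (2 * pi)) - of_int (p (g e))"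
    have "\<bar>x\<bar> < \<eta>" "\<bar>y\<bar> < \<eta>"
      using th[OF g(1)[of e]] p[OF g(1)[of e]] N(2) unfolding g(2) x_def y_def by linarith+
    hence "\<bar>x + y\<bar> < 2 * \<eta>" by linarith
    hence "2 * pi * \<bar>x + y\<bar> < 2 * pi * (2 * \<eta>)" by simp
    moreover have "k * L $ e - z $ e - 2 * pi * of_int (h (g e) + p (g e)) = 2 * pi * (x + y)"
      by (simp add: x_def y_def k_def field_simps)
    ultimately show ?thesis by (simp add: abs_mult \<eta>_def)
  qed
  ultimately show thesis by (rule that)
qed

section \<open>Eigenfunctions and the nullspace on the phase line\<close>

text \<open>
  The rotated Cauchy data \<open>p\<close>, \<open>q\<close> in the proof undo the evolution, so they are constant; this
  yields uniqueness and the explicit form of the solution at once.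
\<close>

lemma harmonic_oscillator_solution:
  fixes u u' :: "real \<Rightarrow> complex"
  assumes k: "k > 0" and l: "l \<ge> 0"
    and u: "\<And>x. x \<in> {0..l} \<Longrightarrow> (u has_vector_derivative u' x) (at x within {0..l})"
    and u': "\<And>x. x \<in> {0..l} \<Longrightarrow>
      (u' has_vector_derivative - (complex_of_real (k\<^sup>2) * u x)) (at x within {0..l})"
    and x: "x \<in> {0..l}"
  shows "u x = u 0 * of_real (cos (k * x)) + u' 0 / of_real k * of_real (sin (k * x))"
    "u' x = u' 0 * of_real (cos (k * x)) - of_real k * u 0 * of_real (sin (k * x))"
proof -
  define p where "p x = of_real k * u x * of_real (cos (k * x)) - u' x * of_real (sin (k * x))" for x
  define q where "q x = of_real k * u x * of_real (sin (k * x)) + u' x * of_real (cos (k * x))" for x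
  have c: "((\<lambda>x. complex_of_real (cos (k * x))) has_vector_derivative of_real (- k * sin (k * x))) (at x within {0..l})"
    and s: "((\<lambda>x. complex_of_real (sin (k * x))) has_vector_derivative of_real (k * cos (k * x))) (at x within {0..l})" for x
    by (auto intro!: has_vector_derivative_of_real derivative_eq_intros
        simp: has_real_derivative_iff_has_vector_derivative[symmetric])
  have "(p has_vector_derivative 0) (at x within {0..l})" if "x \<in> {0..l}" for x
    unfolding p_def
    by (rule has_vector_derivative_eq_rhs, rule has_vector_derivative_diff[OF
          has_vector_derivative_mult[OF has_vector_derivative_mult_right[OF u[OF that]] c]
          has_vector_derivative_mult[OF u'[OF that] s]])
       (simp add: algebra_simps power2_eq_square)
  then obtain cp where "\<And>x. x \<in> {0..l} \<Longrightarrow> p x = cp"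
    using has_vector_derivative_zero_constant[of "{0..l}" p] by auto
  hence p: "p x = p 0" using x l by simp
  have "(q has_vector_derivative 0) (at x within {0..l})" if "x \<in> {0..l}" for x
    unfolding q_def
    by (rule has_vector_derivative_eq_rhs, rule has_vector_derivative_add[OF
          has_vector_derivative_mult[OF has_vector_derivative_mult_right[OF u[OF that]] s]
          has_vector_derivative_mult[OF u'[OF that] c]])
       (simp add: algebra_simps power2_eq_square)
  then obtain cq where "\<And>x. x \<in> {0..l} \<Longrightarrow> q x = cq"
    using has_vector_derivative_zero_constant[of "{0..l}" q] by auto
  hence q: "q x = q 0" using x l by simp
  have one: "complex_of_real (cos (k * x)) * of_real (cos (k * x)) + of_real (sin (k * x)) * of_real (sin (k * x)) = 1"
    by (metis of_real_add of_real_mult of_real_1 power2_eq_square sin_cos_squared_add2)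
  have "of_real k * u x = of_real k * u x *
     (complex_of_real (cos (k * x)) * of_real (cos (k * x)) + of_real (sin (k * x)) * of_real (sin (k * x)))"
    unfolding one by simp
  also have "\<dots> = p x * of_real (cos (k * x)) + q x * of_real (sin (k * x))"
    by (simp add: p_def q_def algebra_simps)
  also have "\<dots> = of_real k * u 0 * of_real (cos (k * x)) + u' 0 * of_real (sin (k * x))"
    unfolding p q by (simp add: p_def q_def)
  finally show "u x = u 0 * of_real (cos (k * x)) + u' 0 / of_real k * of_real (sin (k * x))"
    using k by (simp add: field_simps)
  have "u' x = u' x *
     (complex_of_real (cos (k * x)) * of_real (cos (k * x)) + of_real (sin (k * x)) * of_real (sin (k * x)))"
    unfolding one by simp
  also have "\<dots> = q x * of_real (cos (k * x)) - p x * of_real (sin (k * x))"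
    by (simp add: p_def q_def algebra_simps)
  also have "\<dots> = u' 0 * of_real (cos (k * x)) - of_real k * u 0 * of_real (sin (k * x))"
    unfolding p q by (simp add: p_def q_def)
  finally show "u' x = u' 0 * of_real (cos (k * x)) - of_real k * u 0 * of_real (sin (k * x))" .
qed

lemma kirchhoff_scale_derivatives:
  assumes "z \<noteq> 0"
  shows "kirchhoff G a b (\<lambda>e. z * a' e) (\<lambda>e. z * b' e) \<longleftrightarrow> kirchhoff G a b a' b'"
  unfolding kirchhoff_def sum_distrib_left[symmetric] distrib_left[symmetric]
  using assms by simp

lemma eigenfunction_has_coeffs:
  assumes L: "\<And>e. L $ e > 0" and k: "k > 0" and u: "eigen_eq G L (k\<^sup>2) u"
  obtains X where "has_coeffs L k u X" "X \<in> nullspace G (k *\<^sub>R L)"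
proof -
  obtain u' where u': "\<And>e x. x \<in> {0..L $ e} \<Longrightarrow> (u e has_vector_derivative u' e x) (at x within {0..L $ e})"
      "\<And>e x. x \<in> {0..L $ e} \<Longrightarrow>
        (u' e has_vector_derivative - (complex_of_real (k\<^sup>2) * u e x)) (at x within {0..L $ e})"
    and kh: "kirchhoff G (\<lambda>e. u e 0) (\<lambda>e. u e (L $ e)) (\<lambda>e. u' e 0) (\<lambda>e. - u' e (L $ e))"
    using u unfolding eigen_eq_def neg_laplacian_def by blast
  define X :: "'a coeffs" where
    "X = (\<chi> j. case j of Inl e \<Rightarrow> u e 0 | Inr e \<Rightarrow> u' e 0 / of_real k)"
  have X: "X $ Inl e = u e 0" "X $ Inr e = u' e 0 / of_real k" for e by (simp_all add: X_def)
  have sol: "u e x = u e 0 * of_real (cos (k * x)) + u' e 0 / of_real k * of_real (sin (k * x))"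
    "u' e x = u' e 0 * of_real (cos (k * x)) - of_real k * u e 0 * of_real (sin (k * x))"
    if "x \<in> {0..L $ e}" for e x
    using harmonic_oscillator_solution[OF k less_imp_le[OF L] u'(1) u'(2) that] by auto
  have end1: "u e (L $ e) = X $ Inl e * of_real (cos (k * L $ e)) + X $ Inr e * of_real (sin (k * L $ e))" for e
    using sol(1)[of "L $ e" e] less_imp_le[OF L] by (simp add: X)
  have end2: "- u' e (L $ e) =
      of_real k * (X $ Inl e * of_real (sin (k * L $ e)) - X $ Inr e * of_real (cos (k * L $ e)))" for e
    using k less_imp_le[OF L, of e] unfolding X by (subst sol(2)) (auto simp: algebra_simps)
  have end0: "u' e 0 = of_real k * X $ Inr e" for e using k by (simp add: X)
  show thesis
  proof
    show "has_coeffs L k u X"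
      unfolding has_coeffs_def X using sol(1) by blast
    show "X \<in> nullspace G (k *\<^sub>R L)"
      using kh k unfolding end0 end1 end2 X(1)[symmetric]
      by (simp add: kirchhoff_scale_derivatives nullspace_def)
  qed
qed

text \<open>
  However short an edge is, it contains a point where \<open>sin (k x)\<close> does not vanish, which
  together with \<open>x = 0\<close> determines both coefficients.
\<close>

lemma has_coeffs_unique:
  assumes L: "\<And>e. L $ e > 0" and k: "k > 0" and "has_coeffs L k u X" "has_coeffs L k u Y"
  shows "X = Y"
proof -
  have X: "u e x = X $ Inl e * of_real (cos (k * x)) + X $ Inr e * of_real (sin (k * x))"
    and Y: "u e x = Y $ Inl e * of_real (cos (k * x)) + Y $ Inr e * of_real (sin (k * x))"
    if "x \<in> {0..L $ e}" for x e using assms(3,4) that by (auto simp: has_coeffs_def)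
  have "X $ Inl e = Y $ Inl e \<and> X $ Inr e = Y $ Inr e" for e
  proof -
    define x where "x = min (L $ e) (pi / (2 * k))"
    have "0 < x" "x \<le> L $ e" "k * x \<le> pi / 2"
      using L[of e] k by (auto simp: x_def min_def field_simps)
    moreover have "0 < k * x" using k \<open>0 < x\<close> by simp
    ultimately have "sin (k * x) > 0" by (intro sin_gt_zero) (use pi_gt_zero in linarith)+
    moreover have "X $ Inl e = Y $ Inl e" using X[of 0 e] Y[of 0 e] L[of e] by simp
    ultimately show ?thesis using X[of x e] Y[of x e] \<open>0 < x\<close> \<open>x \<le> L $ e\<close> by simp
  qed
  thus ?thesis unfolding vec_eq_iff by (metis sum.exhaust)
qed

definition wave :: "real \<Rightarrow> 'e coeffs \<Rightarrow> 'e::finite \<Rightarrow> real \<Rightarrow> complex" where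
  "wave k X e x = X $ Inl e * complex_of_real (cos (k * x)) + X $ Inr e * complex_of_real (sin (k * x))"

lemma has_coeffs_wave: "has_coeffs L k (wave k X) X"
  by (simp add: has_coeffs_def wave_def)

lemma eigen_eq_wave:
  assumes "X \<in> nullspace G (k *\<^sub>R L)" "k > 0"
  shows "eigen_eq G L (k\<^sup>2) (wave k X)"
  unfolding eigen_eq_def neg_laplacian_def
proof (intro exI conjI allI ballI)
  let ?u' = "\<lambda>e x. of_real k * (X $ Inr e * complex_of_real (cos (k * x)) - X $ Inl e * complex_of_real (sin (k * x)))"
  have c: "((\<lambda>x. complex_of_real (cos (k * x))) has_vector_derivative of_real (- k * sin (k * x))) (at x within S)"
    and s: "((\<lambda>x. complex_of_real (sin (k * x))) has_vector_derivative of_real (k * cos (k * x))) (at x within S)" for x S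
    by (auto intro!: has_vector_derivative_of_real derivative_eq_intros
        simp: has_real_derivative_iff_has_vector_derivative[symmetric])
  note [derivative_intros] = c s
  fix e x
  show "(wave k X e has_vector_derivative ?u' e x) (at x within {0..L $ e})"
    unfolding wave_def
    by (rule has_vector_derivative_eq_rhs, (rule derivative_intros has_vector_derivative_mult_right)+)
       (simp add: algebra_simps)
  show "(?u' e has_vector_derivative - (complex_of_real (k\<^sup>2) * wave k X e x)) (at x within {0..L $ e})"
    unfolding wave_def
    by (rule has_vector_derivative_eq_rhs, (rule derivative_intros has_vector_derivative_mult_right)+)
       (simp add: algebra_simps power2_eq_square)
next
  have "kirchhoff G (\<lambda>e. wave k X e 0) (\<lambda>e. wave k X e (L $ e)) (\<lambda>e. X $ Inr e)
     (\<lambda>e. X $ Inl e * of_real (sin (k * L $ e)) - X $ Inr e * of_real (cos (k * L $ e)))"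
    using assms(1) by (simp add: nullspace_def wave_def)
  hence "kirchhoff G (\<lambda>e. wave k X e 0) (\<lambda>e. wave k X e (L $ e)) (\<lambda>e. of_real k * (X $ Inr e))
     (\<lambda>e. of_real k * (X $ Inl e * of_real (sin (k * L $ e)) - X $ Inr e * of_real (cos (k * L $ e))))"
    using assms(2) by (subst kirchhoff_scale_derivatives) auto
  thus "kirchhoff G (\<lambda>e. wave k X e 0) (\<lambda>e. wave k X e (L $ e))
     (\<lambda>e. of_real k * (X $ Inr e * complex_of_real (cos (k * 0)) - X $ Inl e * complex_of_real (sin (k * 0))))
     (\<lambda>e. - (of_real k * (X $ Inr e * complex_of_real (cos (k * L $ e)) - X $ Inl e * complex_of_real (sin (k * L $ e)))))"
    by (simp add: algebra_simps)
qed

section \<open>Oscillatory integrals over measurable sets\<close>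

lemma set_integrable_cis:
  assumes "S \<in> sets lebesgue" "S \<subseteq> {0..l}"
  shows "set_integrable lebesgue S (\<lambda>x. cis (k * x))"
proof (rule set_integrable_subset[OF _ assms])
  have "set_integrable lborel {0..l} (\<lambda>x. cis (k * x))"
    by (intro borel_integrable_atLeastAtMost' continuous_intros)
  thus "set_integrable lebesgue {0..l} (\<lambda>x. cis (k * x))"
    unfolding set_integrable_def
    by (subst integrable_completion) (auto dest: borel_measurable_integrable)
qed

definition oscillation :: "real set \<Rightarrow> real \<Rightarrow> complex" where
  "oscillation S k = (LINT x : S | lebesgue. cis (k * x))"

lemma lmeasurable_bounded_by_Icc:
  fixes S :: "real set"
  assumes "S \<in> sets lebesgue" "S \<subseteq> {0..l}"
  shows "S \<in> lmeasurable"
  by (rule fmeasurableI2[OF _ assms(2,1)]) simp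

lemma norm_oscillation_le:
  assumes "S \<in> sets lebesgue" "S \<subseteq> {0..l}"
  shows "norm (oscillation S k) \<le> measure lebesgue S"
proof -
  have "norm (oscillation S k) \<le> (LINT x|lebesgue. norm (indicator S x *\<^sub>R cis (k * x)))"
    unfolding oscillation_def set_lebesgue_integral_def by (rule integral_norm_bound)
  also have "\<dots> = (LINT x|lebesgue. indicator S x)"
    by (rule Bochner_Integration.integral_cong) auto
  finally show ?thesis by simp
qed

lemma oscillation_Un:
  assumes "S \<in> sets lebesgue" "S \<subseteq> {0..l}" "T \<in> sets lebesgue" "T \<subseteq> {0..l}" "S \<inter> T = {}"
  shows "oscillation (S \<union> T) k = oscillation S k + oscillation T k"
  unfolding oscillation_def
  by (rule set_integral_Un[OF assms(5) set_integrable_cis[OF assms(1,2)] set_integrable_cis[OF assms(3,4)]])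

lemma oscillation_Icc:
  assumes "b \<ge> 0" "k \<noteq> 0"
  shows "oscillation {0..b} k = (cis (k * b) - 1) / (\<i> * of_real k)"
proof -
  have d: "((\<lambda>x. cis (k * x) / (\<i> * of_real k)) has_vector_derivative cis (k * x)) (at x within {0..b})" for x
  proof -
    have "((\<lambda>x. cis (k * x)) has_vector_derivative (\<i> * of_real k) * cis (k * x)) (at x within {0..b})"
    proof -
      have "((\<lambda>x. (\<i> * of_real k) * complex_of_real x) has_vector_derivative (\<i> * of_real k) * of_real 1)
          (at x within {0..b})"
        by (intro has_vector_derivative_mult_right has_vector_derivative_of_real)
           (auto intro!: derivative_eq_intros)
      from field_vector_diff_chain_within[OF this has_field_derivative_at_within[OF DERIV_exp]]
      show ?thesis by (simp add: o_def cis_conv_exp mult.assoc)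
    qed
    hence "((\<lambda>x. (1 / (\<i> * of_real k)) * cis (k * x)) has_vector_derivative
        (1 / (\<i> * of_real k)) * ((\<i> * of_real k) * cis (k * x))) (at x within {0..b})"
      by (rule has_vector_derivative_mult_right)
    thus ?thesis using assms(2) by simp
  qed
  have "oscillation {0..b} k = (LINT x|lborel. indicator {0..b} x *\<^sub>R cis (k * x))"
    unfolding oscillation_def set_lebesgue_integral_def
    by (intro integral_completion borel_measurable_integrable
        borel_integrable_atLeastAtMost'[unfolded set_integrable_def] continuous_intros)
  also have "\<dots> = cis (k * b) / (\<i> * of_real k) - cis (k * 0) / (\<i> * of_real k)"
    using assms by (intro integral_FTC_atLeastAtMost d continuous_intros) auto
  finally show ?thesis by (simp add: diff_divide_distrib)
qed

lemma oscillation_Icc_tendsto_0: "(oscillation {0..b} \<longlongrightarrow> 0) at_top"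
proof (cases "b \<ge> 0")
  case True
  have "((\<lambda>k::real. 2 / k) \<longlongrightarrow> 0) at_top" by (intro tendsto_divide_0[OF tendsto_const] filterlim_at_top_imp_at_infinity filterlim_ident)
  moreover have "\<forall>\<^sub>F k in at_top. norm (oscillation {0..b} k) \<le> 2 / k"
    using eventually_gt_at_top[of "0::real"]
  proof eventually_elim
    case (elim k)
    have "norm (cis (k * b) - 1) \<le> 2"
      using norm_triangle_ineq4[of "cis (k * b)" 1] by simp
    thus ?case
      using elim by (simp add: oscillation_Icc[OF True] norm_divide norm_mult divide_right_mono)
  qed
  ultimately show ?thesis
    by (rule Lim_null_comparison[rotated])
next
  case False
  hence "oscillation {0..b} = (\<lambda>k. 0)" by (simp add: oscillation_def set_lebesgue_integral_def fun_eq_iff)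
  thus ?thesis by simp
qed

lemma tendsto_0_approximation:
  fixes f :: "'a \<Rightarrow> 'b::real_normed_vector"
  assumes "\<And>\<epsilon>. \<epsilon> > 0 \<Longrightarrow> \<exists>g. (g \<longlongrightarrow> 0) F \<and> (\<forall>k. norm (f k - g k) < \<epsilon>)"
  shows "(f \<longlongrightarrow> 0) F"
proof (rule tendstoI)
  fix \<epsilon> :: real assume "\<epsilon> > 0"
  then obtain g where g: "(g \<longlongrightarrow> 0) F" "\<And>k. norm (f k - g k) < \<epsilon> / 2"
    using assms[of "\<epsilon> / 2"] by auto
  have "\<forall>\<^sub>F k in F. dist (g k) 0 < \<epsilon> / 2"
    using \<open>\<epsilon> > 0\<close> by (intro tendstoD[OF g(1)]) simp
  thus "\<forall>\<^sub>F k in F. dist (f k) 0 < \<epsilon>"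
  proof eventually_elim
    case (elim k)
    have "norm (f k) \<le> norm (f k - g k) + norm (g k)"
      by (metis diff_add_cancel norm_triangle_ineq)
    thus ?case using elim g(2)[of k] by simp
  qed
qed

text \<open>
  The sets for which the Riemann--Lebesgue lemma holds form a Dynkin system containing the
  intervals: complements within \<open>{0..l}\<close> give differences of integrals, and the tail of a disjoint
  union has small measure, hence small integral uniformly in the frequency.
\<close>

lemma riemann_lebesgue_borel:
  assumes "S \<in> sets (borel :: real measure)"
  shows "(oscillation (S \<inter> {0..l}) \<longlongrightarrow> 0) at_top"
proof -
  have "Int_stable (range (atMost :: real \<Rightarrow> _))"
    unfolding Int_stable_def
  proof clarify
    fix a b :: real
    have "{..a} \<inter> {..b} = {..min a b}" by auto
    thus "{..a} \<inter> {..b} \<in> range atMost" by blast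
  qed
  moreover have "range atMost \<subseteq> Pow (UNIV :: real set)" by simp
  moreover have "S \<in> sigma_sets UNIV (range atMost)"
    using assms by (simp add: borel_eq_atMost)
  ultimately show ?thesis
  proof (induction rule: sigma_sets_induct_disjoint)
    case (basic A)
    then obtain a where "A = {..a}" by auto
    hence "A \<inter> {0..l} = {0..min a l}" by auto
    thus ?case using oscillation_Icc_tendsto_0 by simp
  next
    case empty
    have "oscillation ({} \<inter> {0..l}) = (\<lambda>k. 0)" by (simp add: oscillation_def set_lebesgue_integral_def fun_eq_iff)
    thus ?case by simp
  next
    case (compl A)
    have "A \<in> sets borel" using compl.hyps by (simp add: borel_eq_atMost)
    hence A: "A \<in> sets lebesgue" by (simp add: sets_completionI_sets)
    have eq: "oscillation ((UNIV - A) \<inter> {0..l}) k = oscillation {0..l} k - oscillation (A \<inter> {0..l}) k" for k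
    proof -
      have split: "(UNIV - A) \<inter> {0..l} \<union> A \<inter> {0..l} = {0..l}" by auto
      have "oscillation ((UNIV - A) \<inter> {0..l} \<union> A \<inter> {0..l}) k =
          oscillation ((UNIV - A) \<inter> {0..l}) k + oscillation (A \<inter> {0..l}) k"
        by (rule oscillation_Un[of _ l]) (use A sets.compl_sets[OF A] in auto)
      thus ?thesis unfolding split by (simp only: add_diff_cancel_right')
    qed
    have "((\<lambda>k. oscillation {0..l} k - oscillation (A \<inter> {0..l}) k) \<longlongrightarrow> 0 - 0) at_top"
      by (intro tendsto_diff oscillation_Icc_tendsto_0 compl.IH)
    thus ?case by (simp only: eq[symmetric] diff_0_right add_0_left)
  next
    case (union A)
    have A: "A i \<in> sets lebesgue" for i
    proof -
      have "A i \<in> sets borel" using union.hyps(2) by (auto simp: borel_eq_atMost)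
      thus ?thesis by (simp add: sets_completionI_sets)
    qed
    define U where "U = (\<Union>i. A i) \<inter> {0..l}"
    define V where "V n = (\<Union>i<n. A i) \<inter> {0..l}" for n
    have U: "U \<in> sets lebesgue" "U \<subseteq> {0..l}" and V: "V n \<in> sets lebesgue" "V n \<subseteq> {0..l}" for n
      unfolding U_def V_def using sets.countable_UN[of A UNIV lebesgue] A
      by (simp_all add: image_subset_iff sets.Int sets.finite_UN)
    have VU: "(\<Union>n. V n) = U" by (auto simp: U_def V_def)
    have measure_V: "(\<lambda>n. measure lebesgue (V n)) \<longlonglongrightarrow> measure lebesgue U"
      unfolding VU[symmetric]
    proof (rule Lim_measure_incseq)
      show "incseq V" by (fastforce simp: incseq_def V_def)
      show "emeasure lebesgue (\<Union>n. V n) \<noteq> \<infinity>"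
        unfolding VU using fmeasurableD2[OF lmeasurable_bounded_by_Icc[OF U]] by simp
    qed (use V in auto)
    have Vlim: "(oscillation (V n) \<longlongrightarrow> 0) at_top" for n
    proof (induction n)
      case 0
      have "oscillation (V 0) = (\<lambda>k. 0)" by (simp add: V_def oscillation_def set_lebesgue_integral_def fun_eq_iff)
      thus ?case by simp
    next
      case (Suc n)
      have eq: "oscillation (V (Suc n)) k = oscillation (V n) k + oscillation (A n \<inter> {0..l}) k" for k
      proof -
        have Suc_eq: "V (Suc n) = V n \<union> A n \<inter> {0..l}" by (auto simp: V_def less_Suc_eq)
        have "V n \<inter> (A n \<inter> {0..l}) = {}"
        proof -
          have "A i \<inter> A n = {}" if "i < n" for i
            using union.hyps(1) that by (simp add: disjoint_family_on_def)
          thus ?thesis unfolding V_def by blast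
        qed
        moreover have "A n \<inter> {0..l} \<in> sets lebesgue" by (intro sets.Int A) simp
        ultimately show ?thesis unfolding Suc_eq by (intro oscillation_Un[of _ l] V) simp_all
      qed
      have "((\<lambda>k. oscillation (V n) k + oscillation (A n \<inter> {0..l}) k) \<longlongrightarrow> 0 + 0) at_top"
        by (intro tendsto_add Suc union.IH)
      thus ?case by (simp only: eq[symmetric] diff_0_right add_0_left)
    qed
    show ?case
      unfolding U_def[symmetric]
    proof (rule tendsto_0_approximation)
      fix \<epsilon> :: real assume "\<epsilon> > 0"
      then obtain n where n: "\<bar>measure lebesgue (V n) - measure lebesgue U\<bar> < \<epsilon>"
        using LIMSEQ_D[OF measure_V \<open>\<epsilon> > 0\<close>] by (metis order_refl real_norm_def)
      have "norm (oscillation U k - oscillation (V n) k) < \<epsilon>" for k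
      proof -
        have sub: "V n \<subseteq> U" by (auto simp: U_def V_def)
        have diff: "U - V n \<in> sets lebesgue" "U - V n \<subseteq> {0..l}"
          using U(2) by (intro sets.Diff U V, blast)
        have "oscillation (V n \<union> (U - V n)) k = oscillation (V n) k + oscillation (U - V n) k"
          by (rule oscillation_Un[OF V diff]) blast
        hence "oscillation U k - oscillation (V n) k = oscillation (U - V n) k"
          using sub by (simp add: Un_absorb1)
        moreover have "norm (oscillation (U - V n) k) \<le> measure lebesgue (U - V n)"
          by (rule norm_oscillation_le[OF diff])
        moreover have "measure lebesgue (U - V n) = measure lebesgue U - measure lebesgue (V n)"
          using measurable_measure_Diff[of U lebesgue "V n"] lmeasurable_bounded_by_Icc[OF U] V sub by simp
        ultimately show ?thesis using n by simp
      qed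
      thus "\<exists>g. (g \<longlongrightarrow> 0) at_top \<and> (\<forall>k. norm (oscillation U k - g k) < \<epsilon>)"
        using Vlim by blast
    qed
  qed
qed

proposition riemann_lebesgue_measurable_set:
  assumes "S \<in> sets lebesgue" "S \<subseteq> {0..l}"
  shows "(oscillation S \<longlongrightarrow> 0) at_top"
proof -
  obtain C T where C: "fsigma C" and Tn: "T \<in> null_sets lebesgue" and CT: "C \<union> T = S" "disjnt C T"
    using lebesgue_set_almost_fsigma[OF assms(1)] by blast
  have Cb: "C \<in> sets borel" using C by cases (auto intro!: sets.countable_UN)
  have CI: "C \<inter> {0..l} = C" using CT assms(2) by auto
  have "oscillation S = oscillation C"
  proof
    fix k
    have Ts: "T \<in> sets lebesgue" using Tn by auto
    have Cs: "C \<in> sets lebesgue" using Cb by (simp add: sets_completionI_sets)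
    have "oscillation S k = oscillation C k + oscillation T k"
      unfolding CT(1)[symmetric]
      by (rule oscillation_Un[of _ l]) (use CT assms(2) Cs Ts in \<open>auto simp: disjnt_def\<close>)
    moreover have "norm (oscillation T k) \<le> 0"
      using norm_oscillation_le[of T l k] Ts CT assms(2) measure_eq_0_null_sets[OF Tn] by auto
    ultimately show "oscillation S k = oscillation C k" by simp
  qed
  thus ?thesis using riemann_lebesgue_borel[OF Cb, of l] unfolding CI by simp
qed

section \<open>Mass of a high-frequency eigenfunction\<close>

text \<open>
  The intensity of a standing wave is its mean value plus an oscillation at twice the
  frequency, whose amplitude never exceeds the mean value since the intensity is nonnegative.
\<close>

lemma wave_intensity:
  fixes a b :: complex
  defines "w \<equiv> Complex (((cmod a)\<^sup>2 - (cmod b)\<^sup>2) / 2) (- Re (a * cnj b))"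
  shows "(cmod (a * of_real (cos t) + b * of_real (sin t)))\<^sup>2 =
      ((cmod a)\<^sup>2 + (cmod b)\<^sup>2) / 2 + Re (w * cis (2 * t))"
    and "cmod w \<le> ((cmod a)\<^sup>2 + (cmod b)\<^sup>2) / 2"
proof -
  have c: "(cos t)\<^sup>2 = (1 + cos (2 * t)) / 2" and s: "(sin t)\<^sup>2 = (1 - cos (2 * t)) / 2"
    by (simp_all add: cos_double_cos sin_squared_eq)
  have cs: "sin t * cos t = sin (2 * t) / 2" by (simp add: sin_double)
  have "(cmod (a * of_real (cos t) + b * of_real (sin t)))\<^sup>2 =
      (cmod a)\<^sup>2 * (cos t)\<^sup>2 + (cmod b)\<^sup>2 * (sin t)\<^sup>2 + 2 * Re (a * cnj b) * (sin t * cos t)"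
    unfolding cmod_power2 by (simp add: power2_eq_square algebra_simps)
  also have "\<dots> = ((cmod a)\<^sup>2 + (cmod b)\<^sup>2) / 2 + Re (w * cis (2 * t))"
    unfolding c s cs w_def by (simp add: field_simps)
  finally show "(cmod (a * of_real (cos t) + b * of_real (sin t)))\<^sup>2 =
      ((cmod a)\<^sup>2 + (cmod b)\<^sup>2) / 2 + Re (w * cis (2 * t))" .
  have "\<bar>Re (a * cnj b)\<bar> \<le> cmod a * cmod b"
    using abs_Re_le_cmod[of "a * cnj b"] by (simp add: norm_mult)
  hence "(Re (a * cnj b))\<^sup>2 \<le> (cmod a * cmod b)\<^sup>2"
    by (metis abs_ge_zero power2_abs power_mono)
  hence "(cmod w)\<^sup>2 \<le> (((cmod a)\<^sup>2 - (cmod b)\<^sup>2) / 2)\<^sup>2 + (cmod a * cmod b)\<^sup>2"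
    by (simp only: cmod_power2[of w]) (simp only: w_def complex.sel power2_minus add_left_mono)
  also have "\<dots> = (((cmod a)\<^sup>2 + (cmod b)\<^sup>2) / 2)\<^sup>2"
    by (simp add: power2_eq_square field_simps)
  finally show "cmod w \<le> ((cmod a)\<^sup>2 + (cmod b)\<^sup>2) / 2"
    by (rule power2_le_imp_le) simp
qed

abbreviation half_energy :: "('e::finite) coeffs \<Rightarrow> real ^ 'e" where
  "half_energy X \<equiv> (1 / 2) *\<^sub>R coeff_energy X"

lemma half_energy_nth: "half_energy X $ e = ((cmod (X $ Inl e))\<^sup>2 + (cmod (X $ Inr e))\<^sup>2) / 2"
  by (simp add: coeff_energy_def)

lemma half_energy_nonneg: "half_energy X $ e \<ge> 0"
  unfolding half_energy_nth by simp

lemma edge_mass_estimate: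
  assumes S: "S \<in> sets lebesgue" "S \<subseteq> {0..l}"
  shows "\<bar>(LINT x : S | lebesgue. (cmod (wave k X e x))\<^sup>2) - measure lebesgue S * half_energy X $ e\<bar>
    \<le> half_energy X $ e * cmod (oscillation S (2 * k))"
proof -
  define w where "w = Complex (((cmod (X $ Inl e))\<^sup>2 - (cmod (X $ Inr e))\<^sup>2) / 2)
      (- Re (X $ Inl e * cnj (X $ Inr e)))"
  have int: "integrable lebesgue (\<lambda>x. indicator S x *\<^sub>R cis (2 * k * x))"
    using set_integrable_cis[OF S, of "2 * k"] by (simp add: set_integrable_def)
  have S_int: "integrable lebesgue (indicator S :: real \<Rightarrow> real)"
    using lmeasurable_bounded_by_Icc[OF S] by (auto simp: fmeasurable_def intro!: integrable_real_indicator)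
  have osc: "(LINT x|lebesgue. indicator S x *\<^sub>R cis (2 * k * x)) = oscillation S (2 * k)"
    by (simp add: oscillation_def set_lebesgue_integral_def)
  have "(LINT x : S | lebesgue. (cmod (wave k X e x))\<^sup>2) =
      (LINT x | lebesgue. half_energy X $ e * indicator S x + Re (w * (indicator S x *\<^sub>R cis (2 * k * x))))"
    unfolding set_lebesgue_integral_def wave_def half_energy_nth
    by (rule Bochner_Integration.integral_cong)
       (simp_all add: wave_intensity(1)[of "X $ Inl e" _ "X $ Inr e", folded w_def]
         indicator_def mult.assoc)
  also have "\<dots> = half_energy X $ e * measure lebesgue S + Re (w * oscillation S (2 * k))"
  proof -
    have wint: "integrable lebesgue (\<lambda>x. w * (indicator S x *\<^sub>R cis (2 * k * x)))"
      by (rule integrable_mult_right[OF int])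
    have "(LINT x|lebesgue. w * (indicator S x *\<^sub>R cis (2 * k * x))) = w * oscillation S (2 * k)"
      unfolding osc[symmetric] by (rule Bochner_Integration.integral_mult_right[OF int])
    moreover have "(LINT x|lebesgue. half_energy X $ e * indicator S x) =
        half_energy X $ e * (LINT x|lebesgue. indicator S x)"
      by (rule Bochner_Integration.integral_mult_right[OF S_int])
    moreover have "(LINT x|lebesgue. indicator S x) = measure lebesgue S" by simp
    ultimately show ?thesis
      unfolding Bochner_Integration.integral_add[OF integrable_mult_right[OF S_int] integrable_Re[OF wint]]
        integral_Re[OF wint]
      by (simp only:)
  qed
  finally have "\<bar>(LINT x : S | lebesgue. (cmod (wave k X e x))\<^sup>2) - measure lebesgue S * half_energy X $ e\<bar>
      \<le> cmod (w * oscillation S (2 * k))"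
    using abs_Re_le_cmod[of "w * oscillation S (2 * k)"] by (simp only: mult.commute add_diff_cancel_left')
  also have "\<dots> \<le> half_energy X $ e * cmod (oscillation S (2 * k))"
    unfolding norm_mult half_energy_nth w_def
    by (intro mult_right_mono wave_intensity(2)) simp
  finally show ?thesis .
qed

text \<open>
  The factor by which the mass of a wave of frequency \<open>k\<close> in \<open>\<omega>\<close> can deviate from its
  equidistributed value, relative to its mean energy. It does not depend on the wave.
\<close>

definition relative_remainder :: "real ^ 'e::finite \<Rightarrow> ('e \<Rightarrow> real set) \<Rightarrow> real \<Rightarrow> real" where
  "relative_remainder L \<omega> k = (\<Sum>e\<in>UNIV. cmod (oscillation (\<omega> e) (2 * k)) / L $ e)"

proposition mass_estimate:
  assumes L: "\<And>e. L $ e > 0" and \<omega>: "measurable_part L \<omega>" and u: "has_coeffs L k u X"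
  shows "\<bar>mass \<omega> u - edge_measures \<omega> \<bullet> half_energy X\<bar> \<le> relative_remainder L \<omega> k * (L \<bullet> half_energy X)"
proof -
  define q where "q = half_energy X"
  define o' where "o' e = cmod (oscillation (\<omega> e) (2 * k))" for e
  have q: "q $ e \<ge> 0" for e unfolding q_def by (rule half_energy_nonneg)
  have meas: "\<omega> e \<in> sets lebesgue" "\<omega> e \<subseteq> {0..L $ e}" for e
    using \<omega> by (auto simp: measurable_part_def)
  have "mass \<omega> u = (\<Sum>e\<in>UNIV. LINT x : \<omega> e | lebesgue. (cmod (wave k X e x))\<^sup>2)"
    unfolding mass_def
  proof (intro sum.cong refl set_lebesgue_integral_cong allI impI meas)
    fix e x assume "x \<in> \<omega> e"
    hence "x \<in> {0..L $ e}" using meas by blast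
    thus "(cmod (u e x))\<^sup>2 = (cmod (wave k X e x))\<^sup>2"
      using u by (simp add: has_coeffs_def wave_def)
  qed
  hence "mass \<omega> u - edge_measures \<omega> \<bullet> q =
      (\<Sum>e\<in>UNIV. (LINT x : \<omega> e | lebesgue. (cmod (wave k X e x))\<^sup>2) - measure lebesgue (\<omega> e) * q $ e)"
    by (simp add: inner_vec_def edge_measures_def sum_subtractf)
  also have "\<bar>\<dots>\<bar> \<le> (\<Sum>e\<in>UNIV. \<bar>(LINT x : \<omega> e | lebesgue. (cmod (wave k X e x))\<^sup>2) - measure lebesgue (\<omega> e) * q $ e\<bar>)"
    by (rule sum_abs)
  also have "\<dots> \<le> (\<Sum>e\<in>UNIV. q $ e * o' e)"
    unfolding q_def o'_def by (intro sum_mono edge_mass_estimate[OF meas])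
  also have "\<dots> \<le> (\<Sum>e\<in>UNIV. (o' e / L $ e) * (L \<bullet> q))"
  proof (rule sum_mono)
    fix e
    have "L $ e * q $ e \<le> L \<bullet> q"
      unfolding inner_vec_def inner_real_def
      by (rule member_le_sum) (use q less_imp_le[OF L] in auto)
    hence "(o' e / L $ e) * (L $ e * q $ e) \<le> (o' e / L $ e) * (L \<bullet> q)"
      using L[of e] by (intro mult_left_mono) (auto simp: o'_def)
    thus "q $ e * o' e \<le> (o' e / L $ e) * (L \<bullet> q)"
      using L[of e] by (simp add: mult.commute)
  qed
  also have "\<dots> = relative_remainder L \<omega> k * (L \<bullet> q)"
    by (simp add: relative_remainder_def o'_def sum_distrib_right)
  finally show ?thesis unfolding q_def .
qed

lemma relative_remainder_tendsto_0:
  assumes \<omega>: "measurable_part L \<omega>"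
  shows "(relative_remainder L \<omega> \<longlongrightarrow> 0) at_top"
proof -
  have "((\<lambda>k. cmod (oscillation (\<omega> e) (2 * k)) / L $ e) \<longlongrightarrow> 0) at_top" for e
  proof (rule tendsto_divide_zero, rule tendsto_norm_zero)
    have "filterlim (\<lambda>k::real. 2 * k) at_top at_top"
      by (rule filterlim_tendsto_pos_mult_at_top[OF tendsto_const _ filterlim_ident]) simp
    moreover have "(oscillation (\<omega> e) \<longlongrightarrow> 0) at_top"
      using \<omega> riemann_lebesgue_measurable_set[of "\<omega> e" "L $ e"] by (auto simp: measurable_part_def)
    ultimately show "((\<lambda>k. oscillation (\<omega> e) (2 * k)) \<longlongrightarrow> 0) at_top"
      by (rule filterlim_compose[rotated])
  qed
  thus ?thesis
    unfolding relative_remainder_def by (intro tendsto_null_sum)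
qed

definition whole_graph :: "real ^ 'e::finite \<Rightarrow> 'e \<Rightarrow> real set" where
  "whole_graph L e = {0..L $ e}"

lemma measurable_whole_graph: "measurable_part L (whole_graph L)"
  by (simp add: measurable_part_def whole_graph_def)

lemma edge_measures_whole_graph:
  assumes "\<And>e. L $ e > 0"
  shows "edge_measures (whole_graph L) = L"
  using less_imp_le[OF assms] by (simp add: edge_measures_def whole_graph_def vec_eq_iff)

text \<open>
  With the whole graph as the observed set, the mass is the squared norm: normalized eigenfunctions
  have asymptotically \<open>L \<bullet> q = 1\<close>.
\<close>

lemma normalized_half_energy:
  assumes L: "\<And>e. L $ e > 0" and u: "has_coeffs L k u X" "l2_norm L u = 1"
  shows "\<bar>1 - L \<bullet> half_energy X\<bar> \<le> relative_remainder L (whole_graph L) k * (L \<bullet> half_energy X)"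
proof -
  have "mass (whole_graph L) u = 1"
    using u(2) unfolding l2_norm_def whole_graph_def by simp
  thus ?thesis
    using mass_estimate[OF L measurable_whole_graph u(1)] by (simp add: edge_measures_whole_graph[OF L])
qed

lemma weighted_energy_pos:
  assumes L: "\<And>e. L $ e > 0" and "X \<noteq> 0"
  shows "L \<bullet> coeff_energy X > 0"
proof -
  obtain j where j: "X $ j \<noteq> 0" using \<open>X \<noteq> 0\<close> by (auto simp: vec_eq_iff)
  obtain e where "j = Inl e \<or> j = Inr e" by (cases j) auto
  hence "coeff_energy X $ e > 0"
    using j by (auto simp: coeff_energy_def add_pos_nonneg add_nonneg_pos)
  hence "0 < L $ e * coeff_energy X $ e" using L by simp
  also have "\<dots> \<le> L \<bullet> coeff_energy X"
    unfolding inner_vec_def inner_real_def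
    by (rule member_le_sum) (use less_imp_le[OF L] in \<open>auto simp: coeff_energy_def\<close>)
  finally show ?thesis .
qed

text \<open>
  The hypothesis on the remainder makes the norm of the wave positive, so that it can be normalized.
\<close>

lemma normalized_eigenfunction_exists:
  assumes L: "\<And>e. L $ e > 0" and k: "k > 0" "k *\<^sub>R L \<in> det_manifold G"
    and r: "relative_remainder L (whole_graph L) k < 1"
  obtains u X where "eigen_eq G L (k\<^sup>2) u" "l2_norm L u = 1" "has_coeffs L k u X"
proof -
  have "0 \<in> nullspace G (k *\<^sub>R L)" using subspace_nullspace vec.subspace_0 by blast
  then obtain X where X: "X \<in> nullspace G (k *\<^sub>R L)" "X \<noteq> 0"
    using k(2) unfolding det_manifold_def by blast
  define m where "m = mass (whole_graph L) (wave k X)"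
  have "L \<bullet> half_energy X > 0" using weighted_energy_pos[OF L X(2)] by simp
  hence "relative_remainder L (whole_graph L) k * (L \<bullet> half_energy X) < L \<bullet> half_energy X"
    using r by simp
  hence m: "m > 0"
    using mass_estimate[OF L measurable_whole_graph has_coeffs_wave, of k X]
    unfolding edge_measures_whole_graph[OF L] m_def by linarith
  define c where "c = complex_of_real (1 / sqrt m)"
  define Y where "Y = c *s X"
  have "Y \<in> nullspace G (k *\<^sub>R L)"
    unfolding Y_def by (rule vec.subspace_scale[OF subspace_nullspace X(1)])
  hence "eigen_eq G L (k\<^sup>2) (wave k Y)" using eigen_eq_wave k(1) by blast
  moreover have "l2_norm L (wave k Y) = 1"
  proof -
    have "wave k Y e x = c * wave k X e x" for e x
      by (simp add: wave_def Y_def algebra_simps)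
    hence "mass (whole_graph L) (wave k Y) = (cmod c)\<^sup>2 * m"
      by (simp add: mass_def m_def norm_mult power_mult_distrib sum_distrib_left)
    also have "\<dots> = 1" using m by (simp add: c_def norm_divide power_divide)
    finally show ?thesis by (simp add: l2_norm_def whole_graph_def[abs_def])
  qed
  ultimately show thesis using that has_coeffs_wave by blast
qed

section \<open>Continuity of the Gauss map and returns of the phase line\<close>

text \<open>Eliminating the vertex values turns continuity at the vertices into equations between edge
  data, which persist under limits.\<close>

lemma vertex_values_exist_iff:
  "(\<exists>\<phi>. \<forall>e. a e = \<phi> (src G e) \<and> b e = \<phi> (tgt G e)) \<longleftrightarrow>
   (\<forall>e e'. (src G e = src G e' \<longrightarrow> a e = a e') \<and> (tgt G e = tgt G e' \<longrightarrow> b e = b e') \<and>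
      (src G e = tgt G e' \<longrightarrow> a e = b e'))"
  (is "?lhs \<longleftrightarrow> ?rhs")
proof
  assume ?lhs
  thus ?rhs by metis
next
  assume R: ?rhs
  define \<phi> where "\<phi> v = (if \<exists>e. src G e = v then a (SOME e. src G e = v) else b (SOME e. tgt G e = v))" for v
  have "a e = \<phi> (src G e)" for e
  proof -
    have "src G (SOME e'. src G e' = src G e) = src G e" by (rule someI) simp
    thus ?thesis using R unfolding \<phi>_def by (metis (mono_tags, lifting))
  qed
  moreover have "b e = \<phi> (tgt G e)" for e
  proof (cases "\<exists>e'. src G e' = tgt G e")
    case True
    hence "src G (SOME e'. src G e' = tgt G e) = tgt G e" by (rule someI_ex)
    hence "a (SOME e'. src G e' = tgt G e) = b e" using R by blast
    thus ?thesis unfolding \<phi>_def using True by simp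
  next
    case False
    have "tgt G (SOME e'. tgt G e' = tgt G e) = tgt G e" by (rule someI) simp
    hence "b (SOME e'. tgt G e' = tgt G e) = b e" using R by blast
    thus ?thesis unfolding \<phi>_def using False by simp
  qed
  ultimately show ?lhs by blast
qed

lemma nullspace_closed:
  assumes \<theta>: "\<theta> \<longlonglongrightarrow> z" and X: "X \<longlonglongrightarrow> Y" and mem: "\<And>n. X n \<in> nullspace G (\<theta> n)"
  shows "Y \<in> nullspace G z"
proof -
  define b where "b \<theta> X e = X $ Inl e * complex_of_real (cos (\<theta> $ e)) + X $ Inr e * complex_of_real (sin (\<theta> $ e))"
    for \<theta> :: "real ^ 'a" and X :: "'a coeffs" and e
  define d where "d \<theta> X e = X $ Inl e * complex_of_real (sin (\<theta> $ e)) - X $ Inr e * complex_of_real (cos (\<theta> $ e))"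
    for \<theta> :: "real ^ 'a" and X :: "'a coeffs" and e
  have null: "X \<in> nullspace G \<theta> \<longleftrightarrow>
    (\<forall>e e'. (src G e = src G e' \<longrightarrow> X $ Inl e = X $ Inl e') \<and> (tgt G e = tgt G e' \<longrightarrow> b \<theta> X e = b \<theta> X e') \<and>
      (src G e = tgt G e' \<longrightarrow> X $ Inl e = b \<theta> X e')) \<and>
    (\<forall>v. (\<Sum>e | src G e = v. X $ Inr e) + (\<Sum>e | tgt G e = v. d \<theta> X e) = 0)" for X \<theta>
    unfolding nullspace_def kirchhoff_def Let_def mem_Collect_eq vertex_values_exist_iff b_def d_def ..
  have a_lim: "(\<lambda>n. X n $ j) \<longlonglongrightarrow> Y $ j" for j
    by (intro tendsto_vec_nth X)
  have b_lim: "(\<lambda>n. b (\<theta> n) (X n) e) \<longlonglongrightarrow> b z Y e" for e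
    unfolding b_def by (intro tendsto_intros \<theta> X)
  have d_lim: "(\<lambda>n. d (\<theta> n) (X n) e) \<longlonglongrightarrow> d z Y e" for e
    unfolding d_def by (intro tendsto_intros \<theta> X)
  have ends: "(src G e = src G e' \<longrightarrow> X n $ Inl e = X n $ Inl e') \<and>
      (tgt G e = tgt G e' \<longrightarrow> b (\<theta> n) (X n) e = b (\<theta> n) (X n) e') \<and>
      (src G e = tgt G e' \<longrightarrow> X n $ Inl e = b (\<theta> n) (X n) e')" for e e' n
    by (rule spec[OF spec[OF conjunct1[OF iffD1[OF null mem]]]])
  note mem' = mp[OF conjunct1[OF ends]] mp[OF conjunct1[OF conjunct2[OF ends]]]
    mp[OF conjunct2[OF conjunct2[OF ends]]] spec[OF conjunct2[OF iffD1[OF null mem]]]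
  show ?thesis
  proof (rule iffD2[OF null], intro conjI allI impI)
    fix e e'
    show "Y $ Inl e = Y $ Inl e'" if "src G e = src G e'"
      using a_lim[of "Inl e"] a_lim[of "Inl e'"] unfolding mem'(1)[OF that] by (rule LIMSEQ_unique)
    show "b z Y e = b z Y e'" if "tgt G e = tgt G e'"
      using b_lim[of e] b_lim[of e'] unfolding mem'(2)[OF that] by (rule LIMSEQ_unique)
    show "Y $ Inl e = b z Y e'" if "src G e = tgt G e'"
      using a_lim[of "Inl e"] b_lim[of e'] unfolding mem'(3)[OF that] by (rule LIMSEQ_unique)
  next
    fix v
    have "(\<lambda>n. (\<Sum>e | src G e = v. X n $ Inr e) + (\<Sum>e | tgt G e = v. d (\<theta> n) (X n) e)) \<longlonglongrightarrow>
        (\<Sum>e | src G e = v. Y $ Inr e) + (\<Sum>e | tgt G e = v. d z Y e)"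
      by (intro tendsto_add tendsto_sum a_lim d_lim)
    thus "(\<Sum>e | src G e = v. Y $ Inr e) + (\<Sum>e | tgt G e = v. d z Y e) = 0"
      unfolding mem'(4) by (simp add: LIMSEQ_const_iff)
  qed
qed

lemma det_manifold_nullspace:
  assumes "\<theta> \<in> det_manifold G"
  obtains X where "X \<in> nullspace G \<theta>" "X \<noteq> 0"
proof -
  have "0 \<in> nullspace G \<theta>" using subspace_nullspace vec.subspace_0 by blast
  thus thesis using that assms unfolding det_manifold_def by blast
qed

lemma det_manifoldI: "X \<in> nullspace G \<theta> \<Longrightarrow> X \<noteq> 0 \<Longrightarrow> \<theta> \<in> det_manifold G"
  unfolding det_manifold_def by blast

lemma det_manifold_reg_subset: "det_manifold_reg G \<subseteq> det_manifold G"
proof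
  fix \<theta> assume "\<theta> \<in> det_manifold_reg G"
  hence "vec.dim (nullspace G \<theta>) = 1" by (simp add: det_manifold_reg_def)
  hence "nullspace G \<theta> \<noteq> {0}" by (metis vec.dim_singleton zero_neq_one)
  thus "\<theta> \<in> det_manifold G" by (simp add: det_manifold_def)
qed

text \<open>
  Unit vectors in the nullspaces at \<open>\<theta> n\<close> accumulate, by compactness, at a unit vector of the
  nullspace at \<open>z\<close>. This nullspace is a line, so the energy ratios converge to those defining the
  Gauss map at \<open>z\<close>. A convergent subsequence suffices for the density argument below.
\<close>

lemma normalized_gauss_map_sequentially_continuous:
  fixes G :: "('e::finite, 'v::finite) graph"
  assumes L: "\<And>e. L $ e > 0" and z: "z \<in> det_manifold_reg G"
    and \<theta>: "\<theta> \<longlonglongrightarrow> z" and reg: "\<And>n. \<theta> n \<in> det_manifold_reg G"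
  obtains r where "strict_mono r"
    "(\<lambda>n. normalized_gauss_map G L (\<theta> (r n))) \<longlonglongrightarrow> normalized_gauss_map G L z"
proof -
  have "\<exists>X. X \<in> nullspace G (\<theta> n) \<and> norm X = 1" for n
  proof -
    obtain X where X: "X \<in> nullspace G (\<theta> n)" "X \<noteq> 0"
      using det_manifold_nullspace reg det_manifold_reg_subset by blast
    have eq: "complex_of_real (1 / norm X) *s X = (1 / norm X) *\<^sub>R X"
      by (simp only: vec_eq_iff vector_smult_component vector_scaleR_component)
         (simp add: scaleR_conv_of_real)
    have "(1 / norm X) *\<^sub>R X \<in> nullspace G (\<theta> n)"
      unfolding eq[symmetric] by (rule vec.subspace_scale[OF subspace_nullspace X(1)])
    moreover have "norm ((1 / norm X) *\<^sub>R X) = 1" using X(2) by simp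
    ultimately show ?thesis by blast
  qed
  then obtain X where X: "\<And>n. X n \<in> nullspace G (\<theta> n)" "\<And>n. norm (X n) = 1" by metis
  have "\<forall>n. X n \<in> sphere 0 1" using X(2) by simp
  then obtain Y r where Y: "Y \<in> sphere 0 1" "strict_mono r" "(X \<circ> r) \<longlonglongrightarrow> Y"
    using compact_sphere[of "0 :: 'e coeffs" 1] unfolding compact_def by metis
  have Xr: "(\<lambda>n. X (r n)) \<longlonglongrightarrow> Y" using Y(3) by (simp add: o_def)
  have \<theta>r: "(\<lambda>n. \<theta> (r n)) \<longlonglongrightarrow> z"
    using LIMSEQ_subseq_LIMSEQ[OF \<theta> Y(2)] by (simp add: o_def)
  have Yn: "Y \<in> nullspace G z" by (rule nullspace_closed[OF \<theta>r Xr]) (rule X)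
  have Y0: "Y \<noteq> 0" using Y(1) by auto
  have X0: "X n \<noteq> 0" for n using X(2)[of n] by auto
  have ce: "(\<lambda>n. coeff_energy (X (r n))) \<longlonglongrightarrow> coeff_energy Y"
    unfolding coeff_energy_def by (intro tendsto_vec_lambda tendsto_intros Xr)
  have "(\<lambda>n. (1 / (L \<bullet> coeff_energy (X (r n)))) *\<^sub>R coeff_energy (X (r n))) \<longlonglongrightarrow>
      (1 / (L \<bullet> coeff_energy Y)) *\<^sub>R coeff_energy Y"
    using weighted_energy_pos[OF L Y0] by (intro tendsto_intros ce) auto
  hence "(\<lambda>n. normalized_gauss_map G L (\<theta> (r n))) \<longlonglongrightarrow> normalized_gauss_map G L z"
    by (simp add: normalized_gauss_map_eq[OF z Yn Y0] normalized_gauss_map_eq[OF reg X(1) X0])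
  thus thesis using that Y(2) by blast
qed

lemma nullspace_shift:
  fixes m :: "'e::finite \<Rightarrow> int"
  shows "nullspace G (\<theta> - (\<chi> e. 2 * pi * of_int (m e))) = nullspace G \<theta>"
  by (rule nullspace_periodic, rule exI[of _ "- m e" for e]) simp

text \<open>
  Recurrence brings the phase line close to \<open>z\<close>, but in general not onto the determinant
  manifold. Since the flow direction is \<open>L\<close> itself, a small change of time then puts the phase
  exactly onto the manifold.
\<close>

proposition phase_line_returns_to_det_manifold:
  fixes G :: "('e::finite, 'v::finite) graph"
  assumes L: "\<And>e. L $ e > 0"
    and indep: "\<forall>c :: 'e \<Rightarrow> rat. (\<Sum>e\<in>UNIV. of_rat (c e) * L $ e) = 0 \<longrightarrow> (\<forall>e. c e = 0)"
    and z: "z \<in> det_manifold G" and \<epsilon>: "\<epsilon> > 0"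
  obtains k m where "k > K" "k *\<^sub>R L \<in> det_manifold G"
    "dist (k *\<^sub>R L - (\<chi> e. 2 * pi * of_int (m e))) z < \<epsilon>"
proof -
  have L0: "L \<noteq> 0" using L by (metis less_irrefl zero_index)
  \<comment> \<open>half of \<open>\<epsilon>\<close> is left for the displacement caused by the change of time\<close>
  define \<eta> where "\<eta> = min 1 (\<epsilon> / (2 * norm L))"
  have \<eta>: "\<eta> > 0" "\<eta> \<le> 1" "\<eta> * norm L \<le> \<epsilon> / 2"
    using \<epsilon> L0 by (auto simp: \<eta>_def min_def field_simps)
  obtain \<delta> where \<delta>: "\<delta> > 0"
    "\<And>\<theta>. dist \<theta> z < \<delta> \<Longrightarrow> \<exists>t. \<bar>t\<bar> < \<eta> \<and> \<theta> + t *\<^sub>R L \<in> det_manifold G"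
    using det_manifold_meets_nearby_lines[OF L z \<eta>(1)] by blast
  define \<rho> where "\<rho> = min \<delta> (\<epsilon> / 2)"
  have \<rho>: "\<rho> > 0" using \<delta>(1) \<epsilon> by (simp add: \<rho>_def)
  obtain k m where k: "k > K + 1"
    and m: "\<And>e. \<bar>k * L $ e - z $ e - 2 * pi * of_int (m e)\<bar> < \<rho> / real CARD('e)"
    using phase_line_recurrently_dense[OF indep, of "\<rho> / real CARD('e)" "K + 1" z] \<rho> by auto
  define M :: "real ^ 'e" where "M = (\<chi> e. 2 * pi * of_int (m e))"
  define \<theta> where "\<theta> = k *\<^sub>R L - M"
  have "dist \<theta> z \<le> (\<Sum>e\<in>UNIV. \<bar>(\<theta> - z) $ e\<bar>)"
    unfolding dist_norm by (rule norm_le_l1_cart)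
  also have "\<dots> < (\<Sum>e\<in>(UNIV :: 'e set). \<rho> / real CARD('e))"
    by (rule sum_strict_mono) (use m in \<open>auto simp: \<theta>_def M_def algebra_simps\<close>)
  also have "\<dots> = \<rho>" by simp
  finally have dist: "dist \<theta> z < \<rho>" .
  then obtain t where t: "\<bar>t\<bar> < \<eta>" "\<theta> + t *\<^sub>R L \<in> det_manifold G"
    using \<delta>(2)[of \<theta>] by (auto simp: \<rho>_def)
  have eq: "(k + t) *\<^sub>R L - M = \<theta> + t *\<^sub>R L" by (simp add: \<theta>_def algebra_simps)
  show thesis
  proof
    show "k + t > K" using k t(1) \<eta>(2) by linarith
    show "(k + t) *\<^sub>R L \<in> det_manifold G"
      using t(2) unfolding eq[symmetric] M_def det_manifold_def mem_Collect_eq nullspace_shift .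
    have "dist (\<theta> + t *\<^sub>R L) z \<le> dist (\<theta> + t *\<^sub>R L) \<theta> + dist \<theta> z" by (rule dist_triangle)
    also have "dist (\<theta> + t *\<^sub>R L) \<theta> = \<bar>t\<bar> * norm L" by (simp add: dist_norm)
    also have "\<bar>t\<bar> * norm L < \<eta> * norm L" using t(1) L0 by simp
    also have "\<eta> * norm L + dist \<theta> z < \<epsilon>" using \<eta>(3) dist by (simp add: \<rho>_def)
    finally show "dist ((k + t) *\<^sub>R L - (\<chi> e. 2 * pi * of_int (m e))) z < \<epsilon>"
      unfolding M_def[symmetric] eq by simp
  qed
qed

section \<open>The attainable set and the localization constant\<close>

lemma generic_class_pos: "L \<in> generic_class G \<Longrightarrow> L $ e > 0"
  by (simp add: generic_class_def)

lemma generic_class_independent: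
  fixes G :: "('e::finite, 'v::finite) graph"
  assumes "L \<in> generic_class G"
  shows "\<forall>c :: 'e \<Rightarrow> rat. (\<Sum>e\<in>UNIV. of_rat (c e) * L $ e) = 0 \<longrightarrow> (\<forall>e. c e = 0)"
  using assms by (simp add: generic_class_def)

lemma generic_class_regular:
  "L \<in> generic_class G \<Longrightarrow> k > 0 \<Longrightarrow> k *\<^sub>R L \<in> det_manifold G \<Longrightarrow> k *\<^sub>R L \<in> det_manifold_reg G"
  by (auto simp: generic_class_def)

text \<open>
  The points of return differ from the phase line by lattice vectors, under which the nullspace
  and so the Gauss map are invariant; genericity makes these points regular.
\<close>

lemma gauss_map_dense_along_phase_line:
  fixes G :: "('e::finite, 'v::finite) graph"
  assumes gen: "L \<in> generic_class G" and z: "z \<in> det_manifold_reg G" and \<epsilon>: "\<epsilon> > 0"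
  obtains k where "k > K" "k *\<^sub>R L \<in> det_manifold G"
    "dist (normalized_gauss_map G L (k *\<^sub>R L)) (normalized_gauss_map G L z) < \<epsilon>"
proof -
  note L = generic_class_pos[OF gen]
  note indep = generic_class_independent[OF gen]
  note reg = generic_class_regular[OF gen]
  have zZ: "z \<in> det_manifold G" using z det_manifold_reg_subset by blast
  have "\<exists>k m. k > max 0 K \<and> k *\<^sub>R L \<in> det_manifold G \<and>
      dist (k *\<^sub>R L - (\<chi> e. 2 * pi * of_int (m e))) z < 1 / real (Suc n)" for n
  proof -
    have "1 / real (Suc n) > 0" by simp
    thus ?thesis by (rule phase_line_returns_to_det_manifold[OF L indep zZ, of _ "max 0 K"]) blast
  qed
  then obtain k m where km: "\<And>n. k n > max 0 K" "\<And>n. k n *\<^sub>R L \<in> det_manifold G"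
      "\<And>n. dist (k n *\<^sub>R L - (\<chi> e. 2 * pi * of_int (m n e))) z < 1 / real (Suc n)"
    by metis
  define \<theta> where "\<theta> n = k n *\<^sub>R L - (\<chi> e. 2 * pi * of_int (m n e))" for n
  have null: "nullspace G (\<theta> n) = nullspace G (k n *\<^sub>R L)" for n
    unfolding \<theta>_def by (rule nullspace_shift)
  have \<theta>_lim: "\<theta> \<longlonglongrightarrow> z"
    by (rule LIMSEQ_if_dist_less_inverse) (simp only: \<theta>_def km(3))
  have \<theta>_reg: "\<theta> n \<in> det_manifold_reg G" for n
    using reg[of "k n"] km(1,2)[of n] by (simp add: det_manifold_reg_def null)
  obtain r where r: "strict_mono r"
    "(\<lambda>n. normalized_gauss_map G L (\<theta> (r n))) \<longlonglongrightarrow> normalized_gauss_map G L z"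
    using normalized_gauss_map_sequentially_continuous[OF L z \<theta>_lim \<theta>_reg] by blast
  have same: "normalized_gauss_map G L (\<theta> n) = normalized_gauss_map G L (k n *\<^sub>R L)" for n
    by (simp add: normalized_gauss_map_def null)
  obtain n where "dist (normalized_gauss_map G L (\<theta> (r n))) (normalized_gauss_map G L z) < \<epsilon>"
    using metric_LIMSEQ_D[OF r(2) \<epsilon>] by blast
  thus thesis using that[of "k (r n)"] km(1,2)[of "r n"] by (simp add: same)
qed

text \<open>
  Constant functions put \<open>0\<close> on the determinant manifold; the phase line returns close to it, and
  genericity makes the point of return regular.
\<close>

lemma generic_det_manifold_reg_nonempty:
  fixes G :: "('e::finite, 'v::finite) graph"
  assumes gen: "L \<in> generic_class G"
  shows "det_manifold_reg G \<noteq> {}"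
proof -
  note L = generic_class_pos[OF gen]
  note indep = generic_class_independent[OF gen]
  define X :: "'e coeffs" where "X = (\<chi> j. case j of Inl e \<Rightarrow> 1 | Inr e \<Rightarrow> 0)"
  have "X \<in> nullspace G 0" "X \<noteq> 0"
    by (auto simp: nullspace_def kirchhoff_def X_def vec_eq_iff intro!: exI[of _ "\<lambda>v. 1"] exI[of _ "Inl e" for e])
  hence "0 \<in> det_manifold G" by (rule det_manifoldI)
  then obtain k where "k > 0" "k *\<^sub>R L \<in> det_manifold G"
    using phase_line_returns_to_det_manifold[OF L indep, of 0 G 1 0] by auto
  thus ?thesis using generic_class_regular[OF gen] by blast
qed

text \<open>
  The energy vector of an eigenfunction is a positive multiple of the Gauss map at its phase; by
  \<open>weighted_energy_tendsto_1\<close> below the multiple tends to \<open>1\<close>.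
\<close>

lemma eigenfunction_gauss_map:
  fixes G :: "('e::finite, 'v::finite) graph"
  assumes gen: "L \<in> generic_class G" and k: "k > 0"
    and u: "eigen_eq G L (k\<^sup>2) u" "l2_norm L u = 1" "has_coeffs L k u X"
  shows "k *\<^sub>R L \<in> det_manifold_reg G"
    "half_energy X = (L \<bullet> half_energy X) *\<^sub>R normalized_gauss_map G L (k *\<^sub>R L)"
    "L \<bullet> half_energy X > 0"
proof -
  note L = generic_class_pos[OF gen]
  obtain Y where Y: "has_coeffs L k u Y" "Y \<in> nullspace G (k *\<^sub>R L)"
    using eigenfunction_has_coeffs[OF L k u(1)] by blast
  have X: "X \<in> nullspace G (k *\<^sub>R L)"
    using Y has_coeffs_unique[OF L k u(3) Y(1)] by simp
  have X0: "X \<noteq> 0"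
  proof
    assume "X = 0"
    hence "L \<bullet> half_energy X = 0" by (simp add: coeff_energy_def inner_vec_def)
    thus False using normalized_half_energy[OF L u(3,2)] by simp
  qed
  show reg: "k *\<^sub>R L \<in> det_manifold_reg G"
    by (rule generic_class_regular[OF gen k det_manifoldI[OF X X0]])
  show pos: "L \<bullet> half_energy X > 0"
    using weighted_energy_pos[OF L X0] by simp
  show "half_energy X = (L \<bullet> half_energy X) *\<^sub>R normalized_gauss_map G L (k *\<^sub>R L)"
    using pos by (simp add: normalized_gauss_map_eq[OF reg X X0])
qed

lemma weighted_energy_tendsto_1:
  assumes L: "\<And>e. L $ e > 0" and k: "filterlim k at_top sequentially"
    and u: "\<And>n. l2_norm L (u n) = 1" "\<And>n. has_coeffs L (k n) (u n) (X n)"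
  shows "(\<lambda>n. L \<bullet> half_energy (X n)) \<longlonglongrightarrow> 1"
proof -
  define r where "r n = relative_remainder L (whole_graph L) (k n)" for n
  define s where "s n = L \<bullet> half_energy (X n)" for n
  have r: "r \<longlonglongrightarrow> 0"
    unfolding r_def
    by (rule filterlim_compose[OF relative_remainder_tendsto_0[OF measurable_whole_graph] k])
  have est: "\<bar>1 - s n\<bar> \<le> r n * s n" for n
    unfolding r_def s_def by (rule normalized_half_energy[OF L u(2) u(1)])
  have "\<forall>\<^sub>F n in sequentially. r n < 1 / 2"
    using order_tendstoD(2)[OF r, of "1 / 2"] by simp
  hence "\<forall>\<^sub>F n in sequentially. norm (1 - s n) \<le> 2 * r n"
  proof eventually_elim
    case (elim n)
    have nn: "s n \<ge> 0"
      unfolding s_def inner_vec_def inner_real_def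
      using half_energy_nonneg[of "X n"] less_imp_le[OF L] by (intro sum_nonneg mult_nonneg_nonneg)
    have rn: "r n \<ge> 0"
      unfolding r_def relative_remainder_def using less_imp_le[OF L] by (intro sum_nonneg) auto
    have "r n * s n \<le> 1 / 2 * s n" using nn elim by (intro mult_right_mono) auto
    hence "s n \<le> 2" using est[of n] by linarith
    hence "r n * s n \<le> r n * 2" using rn by (intro mult_left_mono) auto
    thus ?case using est[of n] by simp
  qed
  hence "(\<lambda>n. 1 - s n) \<longlonglongrightarrow> 0"
    using tendsto_mult_right_zero[OF r, of 2] by (rule Lim_null_comparison)
  hence "(\<lambda>n. 1 - (1 - s n)) \<longlonglongrightarrow> 1 - 0" by (intro tendsto_diff tendsto_const)
  thus ?thesis by (simp add: s_def)
qed

proposition attainable_set_eq_closure_gauss_image: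
  fixes G :: "('e::finite, 'v::finite) graph"
  assumes gen: "L \<in> generic_class G"
  shows "attainable_set G L = closure (normalized_gauss_map G L ` det_manifold_reg G)"
proof
  note L = generic_class_pos[OF gen]
  let ?\<Gamma> = "normalized_gauss_map G L"
  show "attainable_set G L \<subseteq> closure (?\<Gamma> ` det_manifold_reg G)"
  proof
    fix q assume "q \<in> attainable_set G L"
    then obtain u k X where
      u: "\<And>n. k n > 0" "\<And>n. eigen_eq G L ((k n)\<^sup>2) (u n)" "\<And>n. l2_norm L (u n) = 1"
        "\<And>n. has_coeffs L (k n) (u n) (X n)"
      and k: "filterlim k at_top sequentially" and q: "(\<lambda>n::nat. half_energy (X n)) \<longlonglongrightarrow> q"
      unfolding attainable_set_def by blast
    note g = eigenfunction_gauss_map[OF gen u]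
    have \<Gamma>: "?\<Gamma> (k n *\<^sub>R L) = (1 / (L \<bullet> half_energy (X n))) *\<^sub>R half_energy (X n)" for n
      using g(3)[of n] by (subst (2) g(2)) simp
    have "(\<lambda>n. (1 / (L \<bullet> half_energy (X n))) *\<^sub>R half_energy (X n)) \<longlonglongrightarrow> (1 / 1) *\<^sub>R q"
      by (intro tendsto_scaleR tendsto_divide tendsto_const q weighted_energy_tendsto_1[OF L k u(3,4)]) simp
    hence "(\<lambda>n. ?\<Gamma> (k n *\<^sub>R L)) \<longlonglongrightarrow> q" by (simp add: \<Gamma>)
    moreover have "?\<Gamma> (k n *\<^sub>R L) \<in> ?\<Gamma> ` det_manifold_reg G" for n using g(1) by blast
    ultimately show "q \<in> closure (?\<Gamma> ` det_manifold_reg G)"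
      unfolding closure_sequential by (intro exI[of _ "\<lambda>n. ?\<Gamma> (k n *\<^sub>R L)"]) simp
  qed
  show "closure (?\<Gamma> ` det_manifold_reg G) \<subseteq> attainable_set G L"
  proof
    fix q assume "q \<in> closure (?\<Gamma> ` det_manifold_reg G)"
    have "\<forall>\<^sub>F k in at_top. relative_remainder L (whole_graph L) k < 1"
      using order_tendstoD(2)[OF relative_remainder_tendsto_0[OF measurable_whole_graph], of 1] by simp
    then obtain K where K: "\<And>k. k \<ge> K \<Longrightarrow> relative_remainder L (whole_graph L) k < 1"
      by (auto simp: eventually_at_top_linorder)
    define P where "P n k u X \<longleftrightarrow> k > real n \<and> k > 0 \<and> eigen_eq G L (k\<^sup>2) u \<and> l2_norm L u = 1 \<and>
        has_coeffs L k u X \<and> dist (?\<Gamma> (k *\<^sub>R L)) q < 1 / real (Suc n)" for n k u X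
    have "\<exists>k u X. P n k u X" for n
    proof -
      have "(1 / real (Suc n)) / 2 > 0" by simp
      then obtain z where z: "z \<in> det_manifold_reg G" "dist (?\<Gamma> z) q < (1 / real (Suc n)) / 2"
        using \<open>q \<in> closure _\<close> unfolding closure_approachable by blast
      obtain k where k: "k > max (real n) K" "k *\<^sub>R L \<in> det_manifold G"
        "dist (?\<Gamma> (k *\<^sub>R L)) (?\<Gamma> z) < (1 / real (Suc n)) / 2"
        using gauss_map_dense_along_phase_line[OF gen z(1), of "(1 / real (Suc n)) / 2" "max (real n) K"]
        by auto
      have k0: "k > 0" using k(1) by (simp add: order_le_less_trans[OF of_nat_0_le_iff])
      obtain u X where "eigen_eq G L (k\<^sup>2) u" "l2_norm L u = 1" "has_coeffs L k u X"
        using normalized_eigenfunction_exists[OF L k0 k(2) K] k(1) by auto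
      moreover have "dist (?\<Gamma> (k *\<^sub>R L)) q < 1 / real (Suc n)"
        using dist_triangle_half_l[OF k(3), of q] z(2) by (simp add: dist_commute)
      moreover have "k > real n" using k(1) by simp
      ultimately show ?thesis unfolding P_def using k0 by blast
    qed
    then obtain k u X where "P n (k n) (u n) (X n)" for n by metis
    hence *: "\<And>n. k n > real n" and u: "\<And>n. k n > 0" "\<And>n. eigen_eq G L ((k n)\<^sup>2) (u n)"
        "\<And>n. l2_norm L (u n) = 1" "\<And>n. has_coeffs L (k n) (u n) (X n)"
      and d: "\<And>n. dist (?\<Gamma> (k n *\<^sub>R L)) q < 1 / real (Suc n)"
      by (simp_all only: P_def)
    have k: "filterlim k at_top sequentially"
      by (rule filterlim_at_top_mono[OF filterlim_real_sequentially]) (use * in \<open>simp add: less_imp_le\<close>)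
    have \<Gamma>_lim: "(\<lambda>n. ?\<Gamma> (k n *\<^sub>R L)) \<longlonglongrightarrow> q"
      by (rule LIMSEQ_if_dist_less_inverse) (rule d)
    have "(\<lambda>n. (L \<bullet> half_energy (X n)) *\<^sub>R ?\<Gamma> (k n *\<^sub>R L)) \<longlonglongrightarrow> 1 *\<^sub>R q"
      by (intro tendsto_scaleR \<Gamma>_lim weighted_energy_tendsto_1[OF L k u(3,4)])
    hence "(\<lambda>n. half_energy (X n)) \<longlonglongrightarrow> q"
      by (simp only: eigenfunction_gauss_map(2)[OF gen u, symmetric] scaleR_one)
    thus "q \<in> attainable_set G L"
      unfolding attainable_set_def mem_Collect_eq
      by (intro exI[of _ u] exI[of _ k] exI[of _ X] conjI allI u k)
  qed
qed

lemma gauss_map_in_simplex: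
  assumes L: "\<And>e. L $ e > 0" and \<theta>: "\<theta> \<in> det_manifold_reg G"
  shows "normalized_gauss_map G L \<theta> $ e \<ge> 0" "L \<bullet> normalized_gauss_map G L \<theta> = 1"
proof -
  obtain X where X: "X \<in> nullspace G \<theta>" "X \<noteq> 0"
    using det_manifold_nullspace \<theta> det_manifold_reg_subset by blast
  have pos: "L \<bullet> coeff_energy X > 0" using weighted_energy_pos[OF L X(2)] .
  show "normalized_gauss_map G L \<theta> $ e \<ge> 0" "L \<bullet> normalized_gauss_map G L \<theta> = 1"
    using pos by (auto simp: normalized_gauss_map_eq[OF \<theta> X] coeff_energy_def)
qed

lemma compact_closure_gauss_image:
  fixes G :: "('e::finite, 'v::finite) graph"
  assumes L: "\<And>e. L $ e > 0"
  shows "compact (closure (normalized_gauss_map G L ` det_manifold_reg G))"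
proof -
  have "norm q \<le> (\<Sum>e\<in>UNIV. 1 / L $ e)" if q: "q \<in> normalized_gauss_map G L ` det_manifold_reg G" for q
  proof -
    have nn: "q $ e \<ge> 0" and one: "L \<bullet> q = 1" for e
      using q gauss_map_in_simplex[OF L] by auto
    have "norm q \<le> (\<Sum>e\<in>UNIV. \<bar>q $ e\<bar>)" by (rule norm_le_l1_cart)
    also have "\<dots> \<le> (\<Sum>e\<in>UNIV. 1 / L $ e)"
    proof (rule sum_mono)
      fix e
      have "L $ e * q $ e \<le> L \<bullet> q"
        unfolding inner_vec_def inner_real_def
        by (rule member_le_sum) (use nn less_imp_le[OF L] in auto)
      thus "\<bar>q $ e\<bar> \<le> 1 / L $ e" using L[of e] nn[of e] one by (simp add: field_simps)
    qed
    finally show ?thesis .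
  qed
  thus ?thesis by (intro compact_closure[THEN iffD2] boundedI)
qed

lemma mass_nonneg: "mass \<omega> u \<ge> 0"
  unfolding mass_def set_lebesgue_integral_def
  by (intro sum_nonneg Bochner_Integration.integral_nonneg) simp

text \<open>
  A sequence of eigenfunctions attaining the minimizer \<open>q0\<close> bounds the infima from above. From
  below, any eigenfunction of high frequency has mass close to the value of the linear functional
  at a positive multiple, close to \<open>1\<close>, of a point of the Gauss image, where that functional is
  at least the minimum.
\<close>

lemma min_mass_above_tendsto:
  fixes G :: "('e::finite, 'v::finite) graph"
  assumes gen: "L \<in> generic_class G" and \<omega>: "measurable_part L \<omega>"
    and q0: "q0 \<in> closure (normalized_gauss_map G L ` det_manifold_reg G)"
    and min: "\<And>q. q \<in> closure (normalized_gauss_map G L ` det_manifold_reg G) \<Longrightarrow>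
      edge_measures \<omega> \<bullet> q0 \<le> edge_measures \<omega> \<bullet> q"
  shows "(min_mass_above G L \<omega> \<longlongrightarrow> edge_measures \<omega> \<bullet> q0) at_top"
proof (rule tendstoI)
  note L = generic_class_pos[OF gen]
  define c where "c = edge_measures \<omega> \<bullet> q0"
  define M where "M \<Lambda> = {mass \<omega> u | u \<mu>. eigen_eq G L \<mu> u \<and> \<mu> \<ge> \<Lambda> \<and> l2_norm L u = 1}" for \<Lambda>
  have bdd: "bdd_below (M \<Lambda>)" for \<Lambda>
    by (rule bdd_belowI[of _ 0]) (auto simp: M_def mass_nonneg)
  define r where "r = relative_remainder L \<omega>"
  define r0 where "r0 = relative_remainder L (whole_graph L)"
  have r: "(r \<longlongrightarrow> 0) at_top" and r0: "(r0 \<longlongrightarrow> 0) at_top"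
    unfolding r_def r0_def by (intro relative_remainder_tendsto_0 \<omega> measurable_whole_graph)+
  have rnn: "r k \<ge> 0" "r0 k \<ge> 0" for k
    unfolding r_def r0_def relative_remainder_def using less_imp_le[OF L] by (auto intro!: sum_nonneg)
  obtain u k X where
    u: "\<And>n. k n > 0" "\<And>n. eigen_eq G L ((k n)\<^sup>2) (u n)" "\<And>n. l2_norm L (u n) = 1"
      "\<And>n. has_coeffs L (k n) (u n) (X n)"
    and k: "filterlim k at_top sequentially" and q: "(\<lambda>n::nat. half_energy (X n)) \<longlonglongrightarrow> q0"
    using q0 unfolding attainable_set_eq_closure_gauss_image[OF gen, symmetric] attainable_set_def by blast
  have mass_lim: "(\<lambda>n. mass \<omega> (u n)) \<longlonglongrightarrow> c"
  proof -
    have "(\<lambda>n. r (k n) * (L \<bullet> half_energy (X n))) \<longlonglongrightarrow> 0 * 1"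
      by (intro tendsto_mult filterlim_compose[OF r k] weighted_energy_tendsto_1[OF L k u(3,4)])
    hence "(\<lambda>n. r (k n) * (L \<bullet> half_energy (X n))) \<longlonglongrightarrow> 0" by simp
    hence "(\<lambda>n. mass \<omega> (u n) - edge_measures \<omega> \<bullet> half_energy (X n)) \<longlonglongrightarrow> 0"
      by (rule Lim_null_comparison[rotated])
         (simp only: real_norm_def r_def mass_estimate[OF L \<omega> u(4)] eventually_True)
    hence "(\<lambda>n. (mass \<omega> (u n) - edge_measures \<omega> \<bullet> half_energy (X n)) +
        edge_measures \<omega> \<bullet> half_energy (X n)) \<longlonglongrightarrow> 0 + edge_measures \<omega> \<bullet> q0"
      by (intro tendsto_add tendsto_inner tendsto_const q)
    thus ?thesis by (simp add: c_def)
  qed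
  have k2: "filterlim (\<lambda>n. (k n)\<^sup>2) at_top sequentially"
    by (intro filterlim_pow_at_top k) simp
  have in_M: "\<forall>\<^sub>F n in sequentially. mass \<omega> (u n) \<in> M \<Lambda>" for \<Lambda>
    using filterlim_at_top[THEN iffD1, OF k2, rule_format, of \<Lambda>]
    by eventually_elim (use u in \<open>unfold M_def, blast\<close>)
  have nonempty: "M \<Lambda> \<noteq> {}" for \<Lambda>
    using eventually_happens[OF in_M[of \<Lambda>]] by auto
  have upper: "Inf (M \<Lambda>) \<le> c" for \<Lambda>
  proof (rule tendsto_lowerbound[OF mass_lim])
    show "\<forall>\<^sub>F n in sequentially. Inf (M \<Lambda>) \<le> mass \<omega> (u n)"
      using in_M[of \<Lambda>] by eventually_elim (intro cInf_lower bdd)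
  qed simp
  fix \<epsilon> :: real assume \<epsilon>: "\<epsilon> > 0"
  \<comment> \<open>error budget below: \<open>\<epsilon> / 4\<close> from the oscillating part of the mass, \<open>\<epsilon> / 2\<close> from the
    deviation of \<open>L \<bullet> q\<close> from \<open>1\<close>\<close>
  define \<delta> where "\<delta> = \<epsilon> / 4 / (1 + \<bar>c\<bar>)"
  have \<delta>: "\<delta> > 0" "\<bar>c\<bar> * \<delta> \<le> \<epsilon> / 4" using \<epsilon> by (auto simp: \<delta>_def field_simps)
  have "\<forall>\<^sub>F k in at_top. r k < \<epsilon> / 8 \<and> r0 k < min (1 / 2) \<delta>"
    using order_tendstoD(2)[OF r, of "\<epsilon> / 8"] order_tendstoD(2)[OF r0, of "min (1 / 2) \<delta>"] \<epsilon> \<delta>(1)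
    by (intro eventually_conj) auto
  then obtain K where K: "\<And>k. k \<ge> K \<Longrightarrow> r k < \<epsilon> / 8 \<and> r0 k < min (1 / 2) \<delta>"
    by (auto simp: eventually_at_top_linorder)
  have lower: "c - 3 / 4 * \<epsilon> \<le> x" if \<Lambda>: "\<Lambda> \<ge> (max 1 K)\<^sup>2" and x: "x \<in> M \<Lambda>" for \<Lambda> x
  proof -
    obtain v \<mu> where v: "x = mass \<omega> v" "eigen_eq G L \<mu> v" "\<mu> \<ge> \<Lambda>" "l2_norm L v = 1"
      using x by (auto simp: M_def)
    define \<kappa> where "\<kappa> = sqrt \<mu>"
    have "max 1 K \<le> \<kappa>" unfolding \<kappa>_def using \<Lambda> v(3) by (intro real_le_rsqrt) simp
    hence \<kappa>: "\<kappa> > 0" "\<kappa> \<ge> K" by auto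
    have "\<mu> \<ge> 0" using \<Lambda> v(3) zero_le_power2[of "max 1 K"] by linarith
    hence eig: "eigen_eq G L (\<kappa>\<^sup>2) v" using v(2) by (simp add: \<kappa>_def)
    obtain Y where Y: "has_coeffs L \<kappa> v Y" using eigenfunction_has_coeffs[OF L \<kappa>(1) eig] by blast
    note g = eigenfunction_gauss_map[OF gen \<kappa>(1) eig v(4) Y]
    define s where "s = L \<bullet> half_energy Y"
    have s0: "s > 0" using g(3) by (simp add: s_def)
    have est0: "\<bar>1 - s\<bar> \<le> r0 \<kappa> * s"
      unfolding r0_def s_def by (rule normalized_half_energy[OF L Y v(4)])
    have "r0 \<kappa> * s \<le> 1 / 2 * s" using K[OF \<kappa>(2)] s0 by (intro mult_right_mono) auto
    hence s2: "s \<le> 2" using est0 by linarith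
    have "r0 \<kappa> * s \<le> \<delta> * 2" using K[OF \<kappa>(2)] s0 s2 rnn \<delta>(1) \<epsilon> by (intro mult_mono) auto
    hence s1: "\<bar>s - 1\<bar> \<le> 2 * \<delta>" using est0 by linarith
    have "c \<le> edge_measures \<omega> \<bullet> normalized_gauss_map G L (\<kappa> *\<^sub>R L)"
      unfolding c_def by (intro min subsetD[OF closure_subset] imageI g(1))
    hence "s * c \<le> s * (edge_measures \<omega> \<bullet> normalized_gauss_map G L (\<kappa> *\<^sub>R L))"
      using s0 by simp
    also have "\<dots> = edge_measures \<omega> \<bullet> half_energy Y"
      by (subst g(2)) (simp only: s_def inner_scaleR_right)
    also have "\<dots> \<le> x + r \<kappa> * s"
      using mass_estimate[OF L \<omega> Y] unfolding v(1) r_def s_def by linarith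
    also have "r \<kappa> * s \<le> \<epsilon> / 8 * 2"
      using K[OF \<kappa>(2)] s0 s2 rnn \<delta>(1) \<epsilon> by (intro mult_mono) auto
    finally have "s * c \<le> x + \<epsilon> / 4" by simp
    moreover have "\<bar>(s - 1) * c\<bar> \<le> 2 * \<delta> * \<bar>c\<bar>"
      unfolding abs_mult using s1 by (intro mult_right_mono) auto
    moreover have "2 * \<delta> * \<bar>c\<bar> \<le> \<epsilon> / 2" using \<delta>(2) by (simp add: mult.commute)
    moreover have "(s - 1) * c = s * c - c" by (simp add: algebra_simps)
    ultimately show ?thesis by linarith
  qed
  have "\<forall>\<^sub>F \<Lambda> in at_top. \<Lambda> \<ge> (max 1 K)\<^sup>2" by (rule eventually_ge_at_top)
  thus "\<forall>\<^sub>F \<Lambda> in at_top. dist (min_mass_above G L \<omega> \<Lambda>) (edge_measures \<omega> \<bullet> q0) < \<epsilon>"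
  proof eventually_elim
    case (elim \<Lambda>)
    have "c - 3 / 4 * \<epsilon> \<le> Inf (M \<Lambda>)"
      by (intro cInf_greatest nonempty lower[OF elim])
    thus ?case
      using upper[of \<Lambda>] \<epsilon> unfolding min_mass_above_def M_def[symmetric] c_def[symmetric] dist_real_def
      by linarith
  qed
qed

theorem corollary2p9:
  fixes G :: "('e::finite, 'v::finite) graph" and L :: "real ^ 'e"
  assumes "L \<in> generic_class G"
  shows "attainable_set G L = closure (normalized_gauss_map G L ` det_manifold_reg G) \<and>
    (\<forall>\<omega>. measurable_part L \<omega> \<longrightarrow>
       (min_mass_above G L \<omega> \<longlongrightarrow> localization_constant G L \<omega>) at_top \<and>
       (\<exists>q \<in> closure (normalized_gauss_map G L ` det_manifold_reg G).
          localization_constant G L \<omega> = edge_measures \<omega> \<bullet> q \<and>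
          (\<forall>q' \<in> closure (normalized_gauss_map G L ` det_manifold_reg G).
             edge_measures \<omega> \<bullet> q \<le> edge_measures \<omega> \<bullet> q')))"
proof (intro conjI allI impI)
  show "attainable_set G L = closure (normalized_gauss_map G L ` det_manifold_reg G)"
    by (rule attainable_set_eq_closure_gauss_image[OF assms])
  fix \<omega> assume \<omega>: "measurable_part L \<omega>"
  let ?C = "closure (normalized_gauss_map G L ` det_manifold_reg G)"
  note L = generic_class_pos[OF assms]
  have "?C \<noteq> {}"
    using generic_det_manifold_reg_nonempty[OF assms] by simp
  moreover have "continuous_on ?C (\<lambda>q. edge_measures \<omega> \<bullet> q)" by (intro continuous_intros)
  ultimately obtain q where q: "q \<in> ?C" "\<And>q'. q' \<in> ?C \<Longrightarrow> edge_measures \<omega> \<bullet> q \<le> edge_measures \<omega> \<bullet> q'"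
    using continuous_attains_inf[OF compact_closure_gauss_image[OF L]] by blast
  have lim: "(min_mass_above G L \<omega> \<longlongrightarrow> edge_measures \<omega> \<bullet> q) at_top"
    by (rule min_mass_above_tendsto[OF assms \<omega> q])
  have loc: "localization_constant G L \<omega> = edge_measures \<omega> \<bullet> q"
    unfolding localization_constant_def by (rule tendsto_Lim[OF _ lim]) simp
  show "(min_mass_above G L \<omega> \<longlongrightarrow> localization_constant G L \<omega>) at_top"
    unfolding loc by (rule lim)
  show "\<exists>q \<in> ?C. localization_constant G L \<omega> = edge_measures \<omega> \<bullet> q \<and>
          (\<forall>q' \<in> ?C. edge_measures \<omega> \<bullet> q \<le> edge_measures \<omega> \<bullet> q')"
    using q loc by blast
qed

end
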